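(* Let $k\ge 22$ be an integer and let $n=2k+2$. Let $G$ be a connected $\{C_3,C_4\}$-free graph of order $n$ with no pendant vertices. Then $q(G)\le q'(n)$, where $q'(n)$ is the largest root of $$x^5-\tfrac12(n+18)x^4+\tfrac32(3n+16)x^3-\tfrac12(27n+20)x^2+4(4n-9)x-6n+24=0.$$ Moreover, equality $q(G)=q'(n)$ holds if and only if $G\cong T_{\frac{n-2}{2}}$.
   Context: All graphs are finite, simple, undirected and connected. The order of a graph is its number of vertices. A pendant vertex is a vertex of degree $1$. $C_r$ is the cycle on $r$ vertices. A graph is $\mathcal F$-free if it contains no member of the family $\mathcal F$ as a (not necessarily induced) subgraph. $q(G)$ denotes the signless Laplacian spectral radius of $G$, i.e. the largest eigenvalue of $Q(G)=D(G)+A(G)$, where $A(G)$ is the adjacency matrix and $D(G)$ the diagonal matrix of vertex degrees. For $r\ge 3$, the theta graph $\theta(2,3^{\,r-1})$ consists of two distinct vertices $x,y$ (the terminal vertices) joined by one path of length $2$ and $r-1$ paths of length $3$ (length = number of edges), all these paths being internally disjoint. Let $P_1,P_2$ be two distinct of these $x$–$y$ paths of length $3$. The graph $T_r$, of order $2r+2$, is obtained from $\theta(2,3^{\,r-1})$ by adding a new vertex $w$ and making $w$ adjacent to exactly two vertices: the neighbor of $x$ on $P_1$ and the neighbor of $y$ on $P_2$. *)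

theory Defs
  imports
    "Graph_Theory.Graph_Theory"
    "Jordan_Normal_Form.Spectral_Radius"
begin

text \<open>
  A finite simple undirected graph is a \<open>pair_graph\<close>: a finite loop-free digraph with a symmetric
  arc relation, each edge being the pair of its two opposite arcs. Hence \<open>out_degree\<close> is the
  degree, and \<open>connected\<close>, \<open>subgraph\<close> and \<open>digraph_iso\<close> are the undirected notions.
\<close>

definition graph_of_edges :: "'a set \<Rightarrow> ('a \<times> 'a) set \<Rightarrow> 'a pair_pre_digraph" where
  "graph_of_edges V E = mk_symmetric (with_proj \<lparr> pverts = V, parcs = E \<rparr>)"

definition cycle_graph :: "nat \<Rightarrow> nat pair_pre_digraph" where
  "cycle_graph r = graph_of_edges {..<r} {(i, Suc i mod r) | i. i < r}"

definition contains_copy :: "('a, 'b) pre_digraph \<Rightarrow> ('c, 'd) pre_digraph \<Rightarrow> bool" where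
  "contains_copy G F \<longleftrightarrow> (\<exists>H. subgraph H G \<and> digraph_iso H F)"

definition family_free :: "'c pair_pre_digraph set \<Rightarrow> 'a pair_pre_digraph \<Rightarrow> bool" where
  "family_free \<F> G \<longleftrightarrow> (\<forall>F\<in>\<F>. \<not> contains_copy (with_proj G) (with_proj F))"

definition pendant_vertex :: "'a pair_pre_digraph \<Rightarrow> 'a \<Rightarrow> bool" where
  "pendant_vertex G v \<longleftrightarrow> v \<in> pverts G \<and> out_degree (with_proj G) v = 1"

text \<open>
  Matrices are indexed by \<open>{0..<n}\<close>, so the vertices are numbered by an arbitrary bijection. Another
  numbering conjugates the matrices below by a permutation matrix and leaves the spectrum unchanged.
\<close>

definition vertex_enum :: "'a pair_pre_digraph \<Rightarrow> nat \<Rightarrow> 'a" where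
  "vertex_enum G = (SOME f. bij_betw f {0..<card (pverts G)} (pverts G))"

definition adjacency_matrix :: "'a pair_pre_digraph \<Rightarrow> real mat" where
  "adjacency_matrix G = mat (card (pverts G)) (card (pverts G))
     (\<lambda>(i, j). if (vertex_enum G i, vertex_enum G j) \<in> parcs G then 1 else 0)"

definition degree_matrix :: "'a pair_pre_digraph \<Rightarrow> real mat" where
  "degree_matrix G = mat_diag (card (pverts G))
     (\<lambda>i. real (out_degree (with_proj G) (vertex_enum G i)))"

definition signless_laplacian :: "'a pair_pre_digraph \<Rightarrow> real mat" where
  "signless_laplacian G = degree_matrix G + adjacency_matrix G"

text \<open>
  The matrix is real symmetric, so all its complex eigenvalues are real and the real spectrum is
  finite and, for a nonempty graph, nonempty.
\<close>

definition signless_spectral_radius :: "'a pair_pre_digraph \<Rightarrow> real" where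
  "signless_spectral_radius G = Max (spectrum (signless_laplacian G))"

text \<open>
  The path of length 2 of the theta graph is \<open>TX - TM - TY\<close>; its \<open>r - 1\<close> paths of length 3 are
  \<open>TX - TA i - TB i - TY\<close> for \<open>i < r - 1\<close>. The vertex \<open>TW\<close> occurs only in \<open>T_graph\<close>.
\<close>

datatype theta_vertex = TX | TY | TM | TA nat | TB nat | TW

definition theta_verts :: "nat \<Rightarrow> theta_vertex set" where
  "theta_verts r = {TX, TY, TM} \<union> TA ` {..<r - 1} \<union> TB ` {..<r - 1}"

definition theta_edges :: "nat \<Rightarrow> (theta_vertex \<times> theta_vertex) set" where
  "theta_edges r = {(TX, TM), (TM, TY)} \<union>
     (\<Union>i<r - 1. {(TX, TA i), (TA i, TB i), (TB i, TY)})"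

text \<open>
  Permuting the paths of length 3 is an automorphism of the theta graph, so taking \<open>P\<^sub>1\<close> and
  \<open>P\<^sub>2\<close> to be the paths with indices 0 and 1 loses nothing. Both exist only for \<open>r \<ge> 3\<close>.
\<close>

definition T_graph :: "nat \<Rightarrow> theta_vertex pair_pre_digraph" where
  "T_graph r = graph_of_edges (insert TW (theta_verts r))
     (theta_edges r \<union> {(TW, TA 0), (TW, TB 1)})"

definition q'_bound :: "nat \<Rightarrow> real" where
  "q'_bound n = Max {x :: real.
     x ^ 5 - 1 / 2 * (real n + 18) * x ^ 4 + 3 / 2 * (3 * real n + 16) * x ^ 3
     - 1 / 2 * (27 * real n + 20) * x ^ 2 + 4 * (4 * real n - 9) * x - 6 * real n + 24 = 0}"

end

theory Submission
  imports Defs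
begin

text \<open>
  Let \<open>lam \<ge> q'(n)\<close> be an eigenvalue with eigenvector \<open>x\<close>. Then \<open>z = \<bar>x\<bar>\<close> is a nonzero
  nonnegative function with \<open>(lam - d u) z(u) \<le> \<Sum>\<^sub>s\<^sub>~\<^sub>u z(s)\<close>, and such a function is
  incompatible with any \<open>w \<ge> 0\<close> satisfying \<open>Q w < lam w\<close> everywhere. Without 3-cycles and
  4-cycles the degrees over the neighbours of a vertex sum to at most \<open>n - 1\<close>, so all degrees
  are at most \<open>k\<close>.

  If no vertex has degree \<open>k\<close>, bounding \<open>z\<close> around a vertex where it is maximal gives a
  contradiction. If exactly one vertex \<open>v\<close> has degree \<open>k\<close>, let \<open>R\<close> be the set of vertices at
  distance at least 2 from \<open>v\<close>; a test function \<open>w\<close> that is affine in the degree within \<open>R\<close>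
  works, and this is where \<open>k \<ge> 22\<close> is needed. If two vertices have degree \<open>k\<close>, the graph is one of
  \<open>\<theta>(3\<^sup>k)\<close>, \<open>\<theta>(2,3\<^sup>k\<^sup>-\<^sup>2,4)\<close> and \<open>T_k\<close>; explicit test functions exclude the first two, and
  \<open>T_k\<close> has a positive eigenvector with eigenvalue \<open>q'(n)\<close>.
\<close>

subsection \<open>The polynomial defining the bound\<close>

lemma q'_bound_poly:
  fixes x :: real
  shows "x ^ 5 - 1 / 2 * (real n + 18) * x ^ 4 + 3 / 2 * (3 * real n + 16) * x ^ 3
     - 1 / 2 * (27 * real n + 20) * x ^ 2 + 4 * (4 * real n - 9) * x - 6 * real n + 24
    = poly [:24 - 6 * real n, 4 * (4 * real n - 9), - (27 * real n + 20) / 2,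
        3 * (3 * real n + 16) / 2, - (real n + 18) / 2, 1:] x"
  by (simp add: field_simps power2_eq_square power3_eq_cube power4_eq_xxxx eval_nat_numeral)

text \<open>This is the eigenvalue equation of \<open>T_k\<close> with its denominators cleared. In
  this form the sign at \<open>x = k\<close> can be read off, since the first summand vanishes there
  and positive terms are subtracted.\<close>

lemma q'_bound_poly_factor:
  fixes x :: real
  assumes "n = 2 * k + 2"
  shows "poly [:24 - 6 * real n, 4 * (4 * real n - 9), - (27 * real n + 20) / 2,
        3 * (3 * real n + 16) / 2, - (real n + 18) / 2, 1:] x
    = (x - k) * ((x - 2) * (x - 3) * (x\<^sup>2 - 5 * x + 3)) - 2 * (x - 3) * (x\<^sup>2 - 5 * x + 3)
      - (real k - 3) * (x - 2) * (x\<^sup>2 - 5 * x + 3) - (x - 3) * (2 * x\<^sup>2 - 7 * x + 4)"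
  using assms by (simp add: field_simps power2_eq_square)

text \<open>The defining equation of \<open>q'_bound\<close> divided by \<open>(x - 2) (x - 3) (x\<^sup>2 - 5 x + 3)\<close>: it is the eigenvalue
  equation of \<open>T_k\<close> at a vertex of degree \<open>k\<close>.\<close>

definition T_fraction :: "nat \<Rightarrow> real \<Rightarrow> real" where
  "T_fraction k x = 2 / (x - 2) + (real k - 3) / (x - 3)
     + (2 * x\<^sup>2 - 7 * x + 4) / ((x - 2) * (x\<^sup>2 - 5 * x + 3))"

lemma quadratic_pos:
  fixes x :: real
  assumes "x > 5"
  shows "x\<^sup>2 - 5 * x + 3 > 0"
proof -
  have "x * (x - 5) > 0" using assms by simp
  then show ?thesis by (simp add: power2_eq_square algebra_simps)
qed

lemma q'_bound_poly_fraction: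
  fixes x :: real
  assumes "n = 2 * k + 2" "x > 5"
  shows "poly [:24 - 6 * real n, 4 * (4 * real n - 9), - (27 * real n + 20) / 2,
        3 * (3 * real n + 16) / 2, - (real n + 18) / 2, 1:] x
    = (x - k - T_fraction k x) * ((x - 2) * (x - 3) * (x\<^sup>2 - 5 * x + 3))"
proof -
  define Q where "Q = x\<^sup>2 - 5 * x + 3"
  have fractions: "(2 / a + b / c + e / (a * d)) * (a * c * d) = 2 * c * d + b * a * d + c * e"
    if "a \<noteq> 0" "c \<noteq> 0" "d \<noteq> 0" for a b c d e :: real
    using that by (simp add: field_simps)
  have "Q > 0" using quadratic_pos[OF assms(2)] by (simp add: Q_def)
  then have "T_fraction k x * ((x - 2) * (x - 3) * Q)
    = 2 * (x - 3) * Q + (real k - 3) * (x - 2) * Q + (x - 3) * (2 * x\<^sup>2 - 7 * x + 4)"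
    using assms(2) fractions[of "x - 2" "x - 3" Q] unfolding T_fraction_def Q_def[symmetric]
    by simp
  then show ?thesis
    unfolding q'_bound_poly_factor[OF assms(1)] Q_def by (simp add: left_diff_distrib)
qed

text \<open>The polynomial is negative at \<open>k\<close> and its leading coefficient is positive,
  so it has a root beyond \<open>k\<close>; to the right of its largest root it cannot be negative.
  Dividing by a factor that is positive for \<open>x > 5\<close> turns this into statements on
  \<open>T_fraction\<close>.\<close>

lemma q'_bound:
  fixes k n :: nat
  assumes k: "k \<ge> 22" and n: "n = 2 * k + 2"
  shows "q'_bound n > k"
    and "q'_bound n - k = T_fraction k (q'_bound n)"
    and "\<And>x. x \<ge> q'_bound n \<Longrightarrow> x - k \<ge> T_fraction k x"
proof -
  define P where "P = [:24 - 6 * real n, 4 * (4 * real n - 9), - (27 * real n + 20) / 2,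
        3 * (3 * real n + 16) / 2, - (real n + 18) / 2, 1:]"
  have q: "q'_bound n = Max {x. poly P x = 0}"
    unfolding q'_bound_def q'_bound_poly P_def ..
  have "P \<noteq> 0" by (simp add: P_def)
  then have fin: "finite {x. poly P x = 0}" by (rule poly_roots_finite)
  have "lead_coeff P > 0" by (simp add: P_def)
  then obtain M where M: "\<And>x. x \<ge> M \<Longrightarrow> poly P x > 0"
    using poly_pinfty_gt_lc[of P] by (metis less_le_trans)
  have root_above: "\<exists>r>x. poly P r = 0" if "poly P x < 0" for x
  proof -
    have "poly P (max M (x + 1)) > 0" by (rule M) simp
    moreover have "x < max M (x + 1)" by simp
    ultimately show ?thesis using poly_IVT_pos[of x "max M (x + 1)" P] that by auto
  qed
  have "poly P k < 0"
  proof -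
    have "(real k)\<^sup>2 - 5 * k + 3 > 0" using quadratic_pos[of k] k by simp
    then have "(real k - 3) * (real k - 2) * ((real k)\<^sup>2 - 5 * k + 3) > 0"
      "2 * (real k - 3) * ((real k)\<^sup>2 - 5 * k + 3) > 0"
      using k by simp_all
    moreover have "real k * (2 * real k - 7) > 0" using k by (intro mult_pos_pos) auto
    then have "2 * (real k)\<^sup>2 - 7 * k + 4 > 0" by (simp add: power2_eq_square algebra_simps)
    then have "(real k - 3) * (2 * (real k)\<^sup>2 - 7 * k + 4) > 0" using k by simp
    ultimately show ?thesis unfolding P_def q'_bound_poly_factor[OF n] by simp
  qed
  from root_above[OF this] obtain r where r: "r > real k" "poly P r = 0" by auto
  then have ne: "{x. poly P x = 0} \<noteq> {}" by auto
  have "r \<le> q'_bound n" unfolding q using fin r by simp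
  then show gt: "q'_bound n > k" using r by simp
  have root: "poly P (q'_bound n) = 0" using Max_in[OF fin ne] q by simp
  have max: "x \<le> q'_bound n" if "poly P x = 0" for x unfolding q using fin that by simp
  have pos: "(x - 2) * (x - 3) * (x\<^sup>2 - 5 * x + 3) > 0" if "x > 5" for x :: real
    using that quadratic_pos[OF that] by simp
  have frac: "poly P x = (x - k - T_fraction k x) * ((x - 2) * (x - 3) * (x\<^sup>2 - 5 * x + 3))"
    if "x > 5" for x
    unfolding P_def by (rule q'_bound_poly_fraction[OF n that])
  have "(x - k - T_fraction k x) \<ge> 0" if x: "x \<ge> q'_bound n" for x
  proof -
    have "poly P x \<ge> 0" using root_above[of x] max x by fastforce
    moreover have x5: "x > 5" using x gt k by simp
    ultimately show ?thesis using frac[OF x5] pos[OF x5] by (simp add: zero_le_mult_iff)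
  qed
  then show "x - k \<ge> T_fraction k x" if x: "x \<ge> q'_bound n" for x using x by force
  have "q'_bound n > 5" using gt k by simp
  then show "q'_bound n - k = T_fraction k (q'_bound n)"
    using frac root pos by (metis diff_eq_diff_eq eq_iff_diff_eq_0 less_irrefl mult_eq_0_iff)
qed

text \<open>After multiplication by \<open>x - 2\<close> the three summands of
  \<open>T_fraction\<close> are 2, at least \<open>k - 3\<close>, and more than 2. The two
  inequalities are all that is used of \<open>lam\<close> when excluding graphs with at most one
  vertex of degree \<open>k\<close>.\<close>

lemma T_fraction_bounds:
  fixes x :: real
  assumes k: "k \<ge> 22" and x: "x > k" and le: "x - k \<ge> T_fraction k x"
  shows "x > real k + 1" and "(x - k) * (x - 2) > real k + 1"
proof -
  have Q: "x\<^sup>2 - 5 * x + 3 > 0" using quadratic_pos[of x] k x by simp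
  have fractions: "(2 / a + b / c + e / (a * d)) * a = 2 + b * (a / c) + e / d"
    if "a \<noteq> 0" "d \<noteq> 0" for a b c d e :: real
    using that by (simp add: distrib_right)
  have "T_fraction k x * (x - 2)
    = 2 + (real k - 3) * ((x - 2) / (x - 3)) + (2 * x\<^sup>2 - 7 * x + 4) / (x\<^sup>2 - 5 * x + 3)"
    using Q k x fractions[of "x - 2" "x\<^sup>2 - 5 * x + 3"] unfolding T_fraction_def by simp
  moreover have "(real k - 3) * ((x - 2) / (x - 3)) \<ge> (real k - 3) * 1"
    using k x by (intro mult_left_mono) auto
  moreover have "(2 * x\<^sup>2 - 7 * x + 4) / (x\<^sup>2 - 5 * x + 3) > 2"
    using Q k x by (simp add: field_simps)
  moreover have "T_fraction k x * (x - 2) \<le> (x - k) * (x - 2)"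
    using le k x by (intro mult_right_mono) auto
  ultimately show *: "(x - k) * (x - 2) > real k + 1" using k by simp
  show "x > real k + 1"
  proof (rule ccontr)
    assume "\<not> ?thesis"
    then have "(x - k) * (x - 2) \<le> 1 * (real k - 1)" using k x by (intro mult_mono) auto
    then show False using * by simp
  qed
qed

subsection \<open>Graphs without 3-cycles and 4-cycles\<close>

text \<open>A neighbourhood function instead of an arc set lets the same facts serve for
  \<open>pair_graph\<close> and, through \<open>induced\<close>, for subgraphs. A 4-cycle amounts to
  two distinct vertices with two common neighbours.\<close>

locale c34_free =
  fixes V :: "'a set" and N :: "'a \<Rightarrow> 'a set"
  assumes finite_V [simp]: "finite V"
    and nbrs_subset: "u \<in> V \<Longrightarrow> N u \<subseteq> V"
    and nbrs_sym: "u \<in> V \<Longrightarrow> w \<in> N u \<Longrightarrow> u \<in> N w"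
    and nbrs_irrefl [simp]: "u \<notin> N u"
    and no_triangle: "u \<in> V \<Longrightarrow> w \<in> N u \<Longrightarrow> N u \<inter> N w = {}"
    and no_4_cycle: "u \<in> V \<Longrightarrow> w \<in> V \<Longrightarrow> u \<noteq> w \<Longrightarrow> a \<in> N u \<inter> N w \<Longrightarrow> b \<in> N u \<inter> N w \<Longrightarrow> a = b"
begin

abbreviation d :: "'a \<Rightarrow> nat" where "d u \<equiv> card (N u)"

lemma nbr_in_V [intro]: "u \<in> V \<Longrightarrow> w \<in> N u \<Longrightarrow> w \<in> V"
  using nbrs_subset by blast

lemma finite_nbrs [simp]: "u \<in> V \<Longrightarrow> finite (N u)"
  using nbrs_subset finite_subset finite_V by blast

lemma card_common_nbrs: "u \<in> V \<Longrightarrow> w \<in> V \<Longrightarrow> u \<noteq> w \<Longrightarrow> card (N u \<inter> N w) \<le> 1"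
  using no_4_cycle[of u w] finite_nbrs by (auto simp: card_le_Suc0_iff_eq)

text \<open>A vertex in the first intersection would close a triangle through \<open>u\<close>; one
  in the second would be a common neighbour of \<open>s\<close> and \<open>t\<close> besides
  \<open>u\<close>.\<close>

lemma second_nbrs:
  assumes "u \<in> V"
  shows "(\<Union>s\<in>N u. N s - {u}) \<inter> insert u (N u) = {}"
    and "\<And>s t. s \<in> N u \<Longrightarrow> t \<in> N u \<Longrightarrow> s \<noteq> t \<Longrightarrow> (N s - {u}) \<inter> (N t - {u}) = {}"
proof -
  show "(\<Union>s\<in>N u. N s - {u}) \<inter> insert u (N u) = {}"
    using no_triangle[OF assms] by blast
  fix s t assume st: "s \<in> N u" "t \<in> N u" "s \<noteq> t"
  then have "u \<in> N s \<inter> N t" using nbrs_sym[OF assms] by blast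
  then show "(N s - {u}) \<inter> (N t - {u}) = {}"
    using no_4_cycle[of s t u] st nbr_in_V[OF assms] by blast
qed

lemma sum_nbrs_second:
  assumes u: "u \<in> V"
  shows "(\<Sum>s\<in>N u. \<Sum>r\<in>N s - {u}. f r) = (\<Sum>r\<in>(\<Union>s\<in>N u. N s - {u}). f r)"
  using u second_nbrs(2)[OF u] nbr_in_V by (intro sum.UNION_disjoint[symmetric]) auto

lemma card_nbr: "u \<in> V \<Longrightarrow> s \<in> N u \<Longrightarrow> d s = card (N s - {u}) + 1"
  by (metis Suc_eq_plus1 card_Suc_Diff1 finite_nbrs nbr_in_V nbrs_sym)

text \<open>The vertex \<open>u\<close>, its neighbours and the sets \<open>N s - {u}\<close> are
  pairwise disjoint, and \<open>d s\<close> counts \<open>s\<close> together with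
  \<open>N s - {u}\<close>.\<close>

lemma sum_nbr_deg:
  assumes u: "u \<in> V"
  shows "(\<Sum>s\<in>N u. d s) + 1 \<le> card V"
proof -
  let ?S = "\<Union>s\<in>N u. N s - {u}"
  have fin: "finite ?S" using u nbr_in_V by auto
  have "(\<Sum>s\<in>N u. d s) = (\<Sum>s\<in>N u. card (N s - {u}) + 1)"
    using card_nbr[OF u] by (intro sum.cong) auto
  also have "\<dots> = card ?S + d u"
    using sum_nbrs_second[OF u, of "\<lambda>_. 1 :: nat"] unfolding sum.distrib card_eq_sum by simp
  also have "\<dots> + 1 = card ?S + card (insert u (N u))" using u by simp
  also have "\<dots> = card (?S \<union> insert u (N u))"
    using fin u second_nbrs(1)[OF u] by (intro card_Un_disjoint[symmetric]) auto
  also have "\<dots> \<le> card V" using u nbr_in_V by (intro card_mono) auto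
  finally show ?thesis by simp
qed

text \<open>Applied to the vertices at distance at least 2 from a vertex of degree
  \<open>k\<close>.\<close>

lemma induced:
  assumes W: "W \<subseteq> V"
  shows "c34_free W (\<lambda>u. N u \<inter> W)"
proof
  show "finite W" using W finite_V finite_subset by blast
next
  fix u w a b assume "u \<in> W" "w \<in> W" "u \<noteq> w" "a \<in> N u \<inter> W \<inter> (N w \<inter> W)" "b \<in> N u \<inter> W \<inter> (N w \<inter> W)"
  then show "a = b" using no_4_cycle[of u w a b] W by blast
next
  fix u w assume "u \<in> W" "w \<in> N u \<inter> W"
  then show "u \<in> N w \<inter> W" "N u \<inter> W \<inter> (N w \<inter> W) = {}"
    using nbrs_sym[of u w] no_triangle[of u w] W by blast+
qed auto

text \<open>Symmetry of the adjacency operator. The type is general enough for natural numbers, so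
  that the lemma also counts degrees and edges.\<close>

lemma sum_nbrs_swap:
  fixes w z :: "'a \<Rightarrow> 'b :: comm_semiring_0"
  shows "(\<Sum>u\<in>V. w u * (\<Sum>s\<in>N u. z s)) = (\<Sum>u\<in>V. z u * (\<Sum>s\<in>N u. w s))"
proof -
  have *: "(\<Sum>s\<in>N u. g s) = (\<Sum>s | s \<in> V \<and> s \<in> N u. g s)" if "u \<in> V" for u and g :: "'a \<Rightarrow> 'b"
    using nbr_in_V[OF that] by (intro sum.cong) auto
  have "(\<Sum>u\<in>V. w u * (\<Sum>s\<in>N u. z s)) = (\<Sum>u\<in>V. \<Sum>s | s \<in> V \<and> s \<in> N u. w u * z s)"
    by (simp add: * sum_distrib_left)
  also have "\<dots> = (\<Sum>s\<in>V. \<Sum>u | u \<in> V \<and> s \<in> N u. w u * z s)"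
    by (rule sum.swap_restrict) auto
  also have "\<dots> = (\<Sum>s\<in>V. \<Sum>u | u \<in> V \<and> u \<in> N s. z s * w u)"
    using nbrs_sym by (intro sum.cong) (auto simp: mult.commute)
  also have "\<dots> = (\<Sum>u\<in>V. z u * (\<Sum>s\<in>N u. w s))"
    by (simp add: * sum_distrib_left)
  finally show ?thesis .
qed

text \<open>By symmetry the left side is the sum over all \<open>u\<close> of the degrees over
  \<open>N u\<close>, and \<open>sum_nbr_deg\<close> bounds each inner sum.\<close>

lemma sum_deg_squares: "(\<Sum>u\<in>V. (d u)\<^sup>2) \<le> card V * (card V - 1)"
proof -
  have "(\<Sum>u\<in>V. (d u)\<^sup>2) = (\<Sum>u\<in>V. \<Sum>s\<in>N u. d s)"
    using sum_nbrs_swap[of d "\<lambda>_. 1"] by (simp add: power2_eq_square)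
  also have "\<dots> \<le> (\<Sum>u\<in>V. card V - 1)"
    using sum_nbr_deg by (intro sum_mono) (metis add_le_imp_le_diff)
  finally show ?thesis by simp
qed

section \<open>Test functions against large eigenvalues\<close>

definition subinvariant :: "real \<Rightarrow> ('a \<Rightarrow> real) \<Rightarrow> bool" where
  "subinvariant lam z \<longleftrightarrow>
    (\<forall>u\<in>V. 0 \<le> z u \<and> (lam - d u) * z u \<le> (\<Sum>s\<in>N u. z s)) \<and> (\<exists>u\<in>V. z u > 0)"

text \<open>Write \<open>Q = D + A\<close> and pair \<open>z\<close> with \<open>w\<close>: the
  pairing of \<open>z\<close> with \<open>Q w\<close> is strictly below \<open>lam\<close> times
  that of \<open>z\<close> with \<open>w\<close>, while the pairing of \<open>Q z\<close> with
  \<open>w\<close> is at least as large as the latter. By symmetry of \<open>Q\<close> the outer two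
  agree. Strictness comes from a vertex with \<open>z v > 0\<close>.\<close>

lemma no_subinvariant_if_strict_superharmonic:
  assumes z: "subinvariant lam z"
    and w: "\<And>u. u \<in> V \<Longrightarrow> w u \<ge> 0" "\<And>u. u \<in> V \<Longrightarrow> (\<Sum>s\<in>N u. w s) < (lam - d u) * w u"
  shows False
proof -
  obtain v where v: "v \<in> V" "z v > 0" using z by (auto simp: subinvariant_def)
  have "(\<Sum>u\<in>V. z u * (\<Sum>s\<in>N u. w s)) < (\<Sum>u\<in>V. z u * ((lam - d u) * w u))"
  proof (rule sum_strict_mono_ex1)
    show "\<forall>u\<in>V. z u * (\<Sum>s\<in>N u. w s) \<le> z u * ((lam - d u) * w u)"
      using z w(2) by (auto simp: subinvariant_def intro: mult_left_mono less_imp_le)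
    show "\<exists>u\<in>V. z u * (\<Sum>s\<in>N u. w s) < z u * ((lam - d u) * w u)"
      using v w(2) by (auto intro: bexI[of _ v])
  qed simp
  also have "\<dots> = (\<Sum>u\<in>V. w u * ((lam - d u) * z u))"
    by (simp add: mult_ac)
  also have "\<dots> \<le> (\<Sum>u\<in>V. w u * (\<Sum>s\<in>N u. z s))"
    using z w by (intro sum_mono mult_left_mono) (auto simp: subinvariant_def)
  finally show False using sum_nbrs_swap[of w z] by simp
qed

end

subsection \<open>A vertex of maximal degree\<close>

text \<open>Test functions are designed with value 1 at vertices of degree \<open>k\<close>, which
  would give mere equality at some neighbours. Lowering 1 to \<open>t\<close> makes those
  inequalities strict while keeping the one at the vertex of degree \<open>k\<close>.\<close>

lemma strict_scale:
  fixes S L :: real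
  assumes "0 \<le> S" "S < L"
  obtains t where "0 \<le> t" "t < 1" "S < L * t"
proof
  \<comment> \<open>The witness is the midpoint of \<open>S / L\<close> and 1.\<close>
  show "S < L * ((1 + S / L) / 2)"
  proof -
    have "L * ((1 + S / L) / 2) = (L + S) / 2" using assms by (simp add: distrib_left)
    then show ?thesis using assms by simp
  qed
qed (use assms in auto)

context c34_free
begin

lemma sum_nbrs_remove:
  "u \<in> V \<Longrightarrow> s \<in> N u \<Longrightarrow> (\<Sum>r\<in>N s. f r) = f u + (\<Sum>r\<in>N s - {u}. f r)"
  by (rule sum.remove) (auto dest: nbrs_sym intro: finite_nbrs)

text \<open>Inclusion-exclusion: the three neighbourhoods lie in \<open>V\<close> and share at most
  one vertex pairwise.\<close>

lemma three_degrees: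
  assumes V: "a \<in> V" "b \<in> V" "c \<in> V" and ne: "a \<noteq> b" "a \<noteq> c" "b \<noteq> c"
  shows "d a + d b + d c \<le> card V + 3"
proof -
  have "card (N a \<union> N b) + card (N a \<inter> N b) = d a + d b"
    using V by (simp add: card_Un_Int[symmetric])
  moreover have "card (N a \<union> N b \<union> N c) + card ((N a \<union> N b) \<inter> N c) = card (N a \<union> N b) + d c"
    using V by (simp add: card_Un_Int[symmetric])
  moreover have "card ((N a \<union> N b) \<inter> N c) \<le> card (N a \<inter> N c) + card (N b \<inter> N c)"
    by (simp add: Int_Un_distrib2 card_Un_le)
  moreover have "card (N a \<inter> N b) \<le> 1" "card (N a \<inter> N c) \<le> 1" "card (N b \<inter> N c) \<le> 1"
    using V ne card_common_nbrs by auto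
  moreover have "card (N a \<union> N b \<union> N c) \<le> card V"
    using V nbr_in_V by (intro card_mono) auto
  ultimately show ?thesis by linarith
qed

end

section \<open>The setting of the theorem, with the properties shared by all
  \<open>lam \<ge> q'(n)\<close>\<close>

locale c34_free_large = c34_free +
  fixes k :: nat and lam :: real
  assumes k: "k \<ge> 22"
    and card_V: "card V = 2 * k + 2"
    and deg_ge2: "u \<in> V \<Longrightarrow> d u \<ge> 2"
    and lam_gt_k: "lam > k"
    and lam_T: "lam - k \<ge> T_fraction k lam"
begin

lemma lam: "lam > real k + 1" "(lam - k) * (lam - 2) > real k + 1"
  using T_fraction_bounds[OF k lam_gt_k lam_T] by auto

lemma sum_excess:
  assumes u: "u \<in> V"
  shows "(\<Sum>s\<in>N u. real (d s) - 1) \<le> 2 * real k + 1 - d u"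
proof -
  have "real ((\<Sum>s\<in>N u. d s) + 1) \<le> real (2 * k + 2)"
    using sum_nbr_deg[OF u] card_V by (simp only: of_nat_le_iff)
  then show ?thesis by (simp add: sum_subtractf)
qed

text \<open>Each neighbour contributes at least 2 in \<open>sum_nbr_deg\<close>, whence
  \<open>2 * d u + 1 \<le> 2 * k + 2\<close>.\<close>

lemma deg_le_k:
  assumes u: "u \<in> V"
  shows "d u \<le> k"
proof -
  have "(\<Sum>s\<in>N u. 2) \<le> (\<Sum>s\<in>N u. d s)"
    using deg_ge2 nbr_in_V[OF u] by (intro sum_mono) auto
  then show ?thesis using sum_nbr_deg[OF u] card_V by simp
qed

text \<open>The neighbours other than \<open>s\<close> contribute at least 2 each. So neighbours of
  a vertex of degree \<open>k\<close> have degree at most 3, and those of a vertex of degree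
  \<open>k - 1\<close> at most 5.\<close>

lemma nbr_deg_bound:
  assumes u: "u \<in> V" and s: "s \<in> N u"
  shows "d s + 2 * d u \<le> 2 * k + 3"
proof -
  have "(\<Sum>t\<in>N u - {s}. 2) \<le> (\<Sum>t\<in>N u - {s}. d t)"
    using deg_ge2 nbr_in_V[OF u] by (intro sum_mono) auto
  moreover have "(\<Sum>t\<in>N u. d t) = d s + (\<Sum>t\<in>N u - {s}. d t)"
    using u s by (simp add: sum.remove)
  moreover have "card (N u - {s}) + 1 = d u"
    using u s card_Suc_Diff1[of "N u" s] by simp
  ultimately show ?thesis using sum_nbr_deg[OF u] card_V by simp
qed

text \<open>If all degrees are below \<open>k\<close>, a vertex \<open>v\<close> where
  \<open>z\<close> is maximal must have degree \<open>k - 1\<close>. The total weight of the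
  vertices outside \<open>v\<close> and \<open>N v\<close> is then bounded below by the inequalities
  around \<open>v\<close> and above by the degrees, and the bounds contradict each other.\<close>

lemma degree_k_if_subinvariant:
  assumes z: "subinvariant lam z"
  shows "\<exists>v\<in>V. d v = k"
proof (rule ccontr)
  assume "\<not> ?thesis"
  then have small: "d u + 1 \<le> k" if "u \<in> V" for u
    using deg_le_k[OF that] that by fastforce
  have "V \<noteq> {}" using z by (auto simp: subinvariant_def)
  then have "Max (z ` V) \<in> z ` V" by simp
  then obtain v where v: "v \<in> V" and "z v = Max (z ` V)" by auto
  then have vmax: "z u \<le> z v" if "u \<in> V" for u using that by simp
  have zv: "z v > 0" using z vmax by (force simp: subinvariant_def)
  define y where "y u = z u / z v" for u
  have y0: "y u \<ge> 0" and y1: "y u \<le> 1" if "u \<in> V" for u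
    using that zv vmax z by (auto simp: y_def subinvariant_def)
  have yv: "y v = 1" using zv by (simp add: y_def)
  have ysub: "(lam - d u) * y u \<le> (\<Sum>s\<in>N u. y s)" if "u \<in> V" for u
    using that z zv
    by (auto simp: y_def subinvariant_def sum_divide_distrib[symmetric] divide_right_mono)
  have gap: "lam - d u > 2" if "u \<in> V" for u using small[OF that] lam(1) by linarith
  \<comment> \<open>First bound, from \<open>y \<le> 1\<close> alone: \<open>y s\<close> is at most
    1 and at most \<open>d s / (lam - d s)\<close>. It is weakened to a multiple of
    \<open>d s - 1\<close> so that \<open>sum_excess\<close> can sum it.\<close>
  have A: "(lam - 2) * y s \<le> 2 * (real (d s) - 1)" if s: "s \<in> V" for s
  proof (cases "2 * real (d s) \<ge> lam")
    case True
    have "(lam - 2) * y s \<le> (lam - 2) * 1"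
      using y1[OF s] lam(1) k by (intro mult_left_mono) auto
    then show ?thesis using True by simp
  next
    case False
    have "(\<Sum>t\<in>N s. y t) \<le> (\<Sum>t\<in>N s. 1)"
      using y1 nbr_in_V[OF s] by (intro sum_mono) auto
    then have 1: "(lam - d s) * y s \<le> d s" using ysub[OF s] by simp
    have "0 \<le> (real (d s) - 2) * (lam - 2 * d s)"
      using False deg_ge2[OF s] by (intro mult_nonneg_nonneg) auto
    then have "d s * (lam - 2) \<le> (2 * (real (d s) - 1)) * (lam - d s)"
      by (simp add: algebra_simps)
    moreover have "((lam - d s) * y s) * (lam - 2) \<le> d s * (lam - 2)"
      using 1 lam(1) k by (intro mult_right_mono) auto
    ultimately have "((lam - 2) * y s) * (lam - d s) \<le> (2 * (real (d s) - 1)) * (lam - d s)"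
      by (simp add: mult_ac)
    then show ?thesis using gap[OF s] by simp
  qed
  \<comment> \<open>Second bound: the first one inserted at all neighbours of
    \<open>u\<close>.\<close>
  have B: "(lam - 2) * ((lam - d u) * y u) \<le> 2 * (2 * real k + 1 - d u)" if u: "u \<in> V" for u
  proof -
    have "(lam - 2) * ((lam - d u) * y u) \<le> (lam - 2) * (\<Sum>s\<in>N u. y s)"
      using ysub[OF u] lam(1) k by (intro mult_left_mono) auto
    also have "\<dots> = (\<Sum>s\<in>N u. (lam - 2) * y s)" by (simp add: sum_distrib_left)
    also have "\<dots> \<le> (\<Sum>s\<in>N u. 2 * (real (d s) - 1))"
      using A nbr_in_V[OF u] by (intro sum_mono) auto
    also have "\<dots> = 2 * (\<Sum>s\<in>N u. real (d s) - 1)" by (simp add: sum_distrib_left)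
    also have "\<dots> \<le> 2 * (2 * real k + 1 - d u)" using sum_excess[OF u] by simp
    finally show ?thesis .
  qed
  have dv: "d v + 1 = k"
  proof (rule ccontr)
    assume "\<not> ?thesis"
    then have dv: "real (d v) + 2 \<le> k" using small[OF v] by linarith
    \<comment> \<open>The second bound at \<open>v\<close>, with \<open>2 * (lam - d v)\<close>
      moved to the left.\<close>
    have "(lam - 4) * (lam - d v) \<le> 2 * (2 * real k + 1 - lam)"
      using B[OF v] yv by (simp add: algebra_simps)
    moreover have "(real k - 3) * 3 \<le> (lam - 4) * (lam - d v)"
      using dv lam(1) k by (intro mult_mono) auto
    ultimately show False using k lam(1) by simp
  qed
  define R where "R = V - insert v (N v)"
  have cardR: "card R = k + 2"
    using v dv card_V nbrs_subset[OF v] by (simp add: R_def card_Diff_subset)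
  have RV: "R \<subseteq> V" "v \<notin> R" by (auto simp: R_def)
  have finR: "finite R" using RV finite_subset finite_V by blast
  \<comment> \<open>The neighbours of \<open>v\<close> have degree at most 5 and total weight at
    least \<open>lam - d v > 2\<close>. Summing their inequalities gives more than
    \<open>2 * (k - 4)\<close>, of which \<open>v\<close> supplies \<open>d v = k - 1\<close>; the
    rest must come from \<open>R\<close>.\<close>
  have X1: "(\<Sum>r\<in>R. y r) > real k - 7"
  proof -
    have "(\<Sum>a\<in>N v. (lam - 5) * y a) \<le> (\<Sum>a\<in>N v. \<Sum>s\<in>N a. y s)"
    proof (rule sum_mono)
      fix a assume a: "a \<in> N v"
      have "(lam - 5) * y a \<le> (lam - d a) * y a"
        using nbr_deg_bound[OF v a] dv y0 nbr_in_V[OF v a] by (intro mult_right_mono) auto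
      then show "(lam - 5) * y a \<le> (\<Sum>s\<in>N a. y s)" using ysub[OF nbr_in_V[OF v a]] by simp
    qed
    also have "\<dots> = (\<Sum>a\<in>N v. 1 + (\<Sum>s\<in>N a - {v}. y s))"
      using sum_nbrs_remove[OF v, of _ y] yv by (intro sum.cong) auto
    also have "\<dots> = d v + (\<Sum>r\<in>(\<Union>a\<in>N v. N a - {v}). y r)"
      unfolding sum.distrib sum_nbrs_second[OF v] by simp
    also have "\<dots> \<le> d v + (\<Sum>r\<in>R. y r)"
      using second_nbrs(1)[OF v] nbr_in_V v y0 finR RV
      by (intro add_left_mono sum_mono2) (auto simp: R_def)
    finally have "(lam - 5) * (\<Sum>a\<in>N v. y a) \<le> d v + (\<Sum>r\<in>R. y r)"
      by (simp add: sum_distrib_left)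
    moreover have "(lam - 5) * (lam - d v) \<le> (lam - 5) * (\<Sum>a\<in>N v. y a)"
      using ysub[OF v] yv k lam(1) by (intro mult_left_mono) auto
    moreover have "(real k - 4) * 2 < (lam - 5) * (lam - d v)"
      using gap[OF v] k lam(1) by (intro mult_strict_mono) auto
    moreover have "real (d v) + 1 = k" using dv by linarith
    ultimately show ?thesis by argo
  qed
  \<comment> \<open>By \<open>three_degrees\<close> two vertices of \<open>R\<close> have degree sum
    at most \<open>k + 6\<close>, so only one can exceed half of it.\<close>
  define B where "B = {r \<in> R. 2 * d r > k + 6}"
  have "card B \<le> 1"
  proof -
    have "r = s" if "r \<in> B" "s \<in> B" for r s
    proof (rule ccontr)
      assume "r \<noteq> s"
      moreover have rs: "r \<in> V" "r \<noteq> v" "s \<in> V" "s \<noteq> v"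
        using that RV by (auto simp: B_def)
      ultimately have "d r + d s + d v \<le> 2 * k + 5"
        using three_degrees[of r s v] rs v card_V by simp
      then show False using that dv by (auto simp: B_def)
    qed
    then show ?thesis using finR by (simp add: card_le_Suc0_iff_eq B_def)
  qed
  \<comment> \<open>The second bound on \<open>y r\<close>, which grows with the degree, taken at
    \<open>lam = k + 1\<close> and degree \<open>(k + 6) / 2\<close>.\<close>
  define c where "c = 2 * (3 * real k - 4) / ((real k - 1) * (real k - 4))"
  have P: "(real k - 1) * (real k - 4) > 0" using k by simp
  then have c0: "c \<ge> 0" using k by (simp add: c_def)
  have "y r \<le> c" if r: "r \<in> R - B" for r
  proof -
    have rV: "r \<in> V" and dr: "2 * real (d r) \<le> k + 6" using r RV by (auto simp: B_def)
    have "0 \<le> k * (real k + 6 - 2 * d r)" using dr by simp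
    then have "(2 * (2 * real k + 1 - d r)) * (real k - 4) \<le> 2 * (3 * real k - 4) * (real k + 1 - d r)"
      by (simp add: algebra_simps)
    also have "\<dots> \<le> 2 * (3 * real k - 4) * (lam - d r)"
      using lam(1) k by (intro mult_left_mono) auto
    finally have 1: "(2 * (2 * real k + 1 - d r)) * (real k - 4) \<le> 2 * (3 * real k - 4) * (lam - d r)" .
    have "(real k - 1) * ((lam - d r) * y r) \<le> (lam - 2) * ((lam - d r) * y r)"
      using lam(1) k gap[OF rV] y0[OF rV] by (intro mult_right_mono mult_nonneg_nonneg) auto
    also have "\<dots> \<le> 2 * (2 * real k + 1 - d r)" by (rule B[OF rV])
    finally have "(real k - 1) * ((lam - d r) * y r) * (real k - 4) \<le> 2 * (2 * real k + 1 - d r) * (real k - 4)"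
      using k by (intro mult_right_mono) auto
    with 1 have "((real k - 1) * (real k - 4) * y r) * (lam - d r) \<le> (2 * (3 * real k - 4)) * (lam - d r)"
      by (simp add: mult_ac)
    then have "(real k - 1) * (real k - 4) * y r \<le> 2 * (3 * real k - 4)"
      using gap[OF rV] by simp
    then show ?thesis using P unfolding c_def by (simp add: pos_le_divide_eq mult.commute)
  qed
  then have "(\<Sum>r\<in>R - B. y r) \<le> (\<Sum>r\<in>R - B. c)" by (intro sum_mono) auto
  also have "\<dots> \<le> (k + 2) * c"
    using c0 cardR card_mono[OF finR, of "R - B"] by (auto intro!: mult_right_mono)
  finally have "(\<Sum>r\<in>R - B. y r) \<le> (k + 2) * c" .
  moreover have "(\<Sum>r\<in>B. y r) \<le> (\<Sum>r\<in>B. 1)"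
    using RV y1 by (intro sum_mono) (auto simp: B_def)
  moreover have "(\<Sum>r\<in>R. y r) = (\<Sum>r\<in>R - B. y r) + (\<Sum>r\<in>B. y r)"
    using finR by (intro sum.subset_diff) (auto simp: B_def)
  ultimately have "real k - 7 < 1 + (k + 2) * c" using X1 \<open>card B \<le> 1\<close> by simp
  moreover have "(k + 2) * c \<le> real k - 8"
  proof -
    have "(real k - 8) * ((real k - 1) * (real k - 4)) - (real k + 2) * (2 * (3 * real k - 4))
        = real k * real k * (real k - 19) + (40 * real k - 16)"
      by (simp add: algebra_simps)
    moreover have "real k * real k * (real k - 19) \<ge> 0" "40 * real k - 16 \<ge> 0" using k by auto
    ultimately have "(real k + 2) * (2 * (3 * real k - 4)) \<le> (real k - 8) * ((real k - 1) * (real k - 4))"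
      by linarith
    then show ?thesis using pos_divide_le_eq[OF P] unfolding c_def by (simp add: add.commute)
  qed
  ultimately show False using k by linarith
qed

end

subsection \<open>A second vertex of maximal degree\<close>

context c34_free_large
begin

text \<open>The test function is close to 1 at \<open>v\<close>, equal to \<open>W\<close> on
  \<open>R\<close>, and on \<open>N v\<close> it is obtained by solving the equations there. What
  remains is a quadratic inequality in the inner degree at each vertex of \<open>R\<close>, and at
  \<open>v\<close> a bound on the total weight of \<open>R\<close>.\<close>

lemma second_degree_k_if_subinvariant:
  assumes z: "subinvariant lam z" and v: "v \<in> V" and dv: "d v = k"
  shows "\<exists>y\<in>V. y \<noteq> v \<and> d y = k"
proof (rule ccontr)
  assume "\<not> ?thesis"
  then have small: "d u + 1 \<le> k" if "u \<in> V" "u \<noteq> v" for u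
    using deg_le_k[OF that(1)] that by fastforce
  define R where "R = V - insert v (N v)"
  have RV: "R \<subseteq> V" "v \<notin> R" "N v \<inter> R = {}" by (auto simp: R_def)
  have V: "V = insert v (N v \<union> R)" using v nbr_in_V[OF v] by (auto simp: R_def)
  have finR: "finite R" using RV finite_subset finite_V by blast
  have cardR: "card R = k + 1"
    using v dv card_V nbrs_subset[OF v] by (simp add: R_def card_Diff_subset)
  interpret R: c34_free R "\<lambda>u. N u \<inter> R" by (rule induced[OF RV(1)])
  let ?D = "\<lambda>r. real (card (N r \<inter> R))"
  have NA: "N a - {v} = N a \<inter> R" if "a \<in> N v" for a
    using second_nbrs(1)[OF v] that nbr_in_V[OF nbr_in_V[OF v that]] by (auto simp: R_def)
  have dA3: "d a \<le> 3" if "a \<in> N v" for a using nbr_deg_bound[OF v that] dv by simp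
  have cardNA: "real (card (N a \<inter> R)) = real (d a) - 1" if "a \<in> N v" for a
    using card_nbr[OF v that] NA[OF that] by simp
  have NR: "N r = (N r \<inter> N v) \<union> (N r \<inter> R)" if "r \<in> R" for r
    using that nbrs_sym[of r] nbr_in_V[of r] by (auto simp: R_def)
  have NRA: "N r \<inter> N v = {} \<or> (\<exists>a. N r \<inter> N v = {a})" if "r \<in> R" for r
    using no_4_cycle[of r v] that v RV by (metis is_singletonI' is_singleton_def subsetD)
  have R_deg: "(\<Sum>s\<in>N r \<inter> R. ?D s) \<le> k" if "r \<in> R" for r
    using R.sum_nbr_deg[OF that] cardR by (metis Suc_eq_plus1 Suc_le_mono of_nat_le_iff of_nat_sum)
  \<comment> \<open>This scale makes the bound \<open>g * (k - 4)\<close> on \<open>N v\<close>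
    consistent with the largest possible values of \<open>W\<close>, which is \<open>g_eq\<close>.
    The factor \<open>k - 4\<close> is what the vertices of \<open>R\<close> with a neighbour in
    \<open>N v\<close> tolerate.\<close>
  define g where "g = 1 / ((real k)\<^sup>2 - 10 * k + 14)"
  have "real k * (real k - 10) \<ge> 0" using k by simp
  then have pos: "(real k)\<^sup>2 - 10 * k + 14 > 0" by (simp add: power2_eq_square algebra_simps)
  then have g0: "g > 0" by (simp add: g_def)
  have g_eq: "1 + g * (4 * real k - 6) = g * (real k - 4) * (real k - 2)"
    using pos by (simp add: g_def field_simps power2_eq_square)
  define W where "W r = g * (2 * ?D r + 1)" for r
  \<comment> \<open>Solves the equation at \<open>a\<close> for the value 1 at
    \<open>v\<close>.\<close>
  define wA where "wA a = (1 + (\<Sum>r\<in>N a \<inter> R. W r)) / (lam - d a)" for a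
  have W0: "W r \<ge> 0" for r using g0 by (simp add: W_def)
  have gapA: "lam - d a > real k - 2" if "a \<in> N v" for a using dA3[OF that] lam(1) by simp
  have wA_eq: "(lam - d a) * wA a = 1 + (\<Sum>r\<in>N a \<inter> R. W r)" if "a \<in> N v" for a
    using gapA[OF that] k by (simp add: wA_def)
  have wA0: "wA a \<ge> 0" if "a \<in> N v" for a
    using gapA[OF that] k W0 by (auto simp: wA_def intro!: divide_nonneg_nonneg add_nonneg_nonneg sum_nonneg)
  have wA_le: "wA a \<le> g * (real k - 4)" if a: "a \<in> N v" for a
  proof -
    have aV: "a \<in> V" using nbr_in_V v a by blast
    have "W r \<le> g * (2 * real k - 3)" if r: "r \<in> N a \<inter> R" for r
    proof -
      have rV: "r \<in> V" using r RV by auto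
      have "a \<in> N r" using nbrs_sym[OF aV] r by simp
      then have "card (N r \<inter> R) < d r"
        using a RV rV by (intro psubset_card_mono) auto
      then have "?D r + 2 \<le> k" using small[OF rV] r RV by force
      then show ?thesis using g0 k by (simp add: W_def)
    qed
    then have "(\<Sum>r\<in>N a \<inter> R. W r) \<le> (real (d a) - 1) * (g * (2 * real k - 3))"
      unfolding cardNA[OF a, symmetric] by (rule sum_bounded_above)
    also have "\<dots> \<le> 2 * (g * (2 * real k - 3))"
      using dA3[OF a] g0 k by (intro mult_right_mono) auto
    also have "\<dots> = g * (4 * real k - 6)" by simp
    finally have "(lam - d a) * wA a \<le> g * (real k - 4) * (real k - 2)"
      unfolding wA_eq[OF a] using g_eq k by simp
    moreover have "(real k - 2) * wA a \<le> (lam - d a) * wA a"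
      using gapA[OF a] wA0[OF a] by (intro mult_right_mono) auto
    ultimately have "(real k - 2) * wA a \<le> g * (real k - 4) * (real k - 2)"
      by (rule order_trans[rotated])
    then have "wA a * (real k - 2) \<le> g * (real k - 4) * (real k - 2)"
      by (simp only: mult.commute)
    then show ?thesis using k by (simp add: mult_le_cancel_right)
  qed
  define S where "S = (\<Sum>a\<in>N v. wA a)"
  have S0: "S \<ge> 0" unfolding S_def using wA0 by (rule sum_nonneg)
  have "S < lam - k"
  proof -
    \<comment> \<open>The tangent to the square at 4 converts the bound on the squared degrees
      within \<open>R\<close> into one on the degrees.\<close>
    have "(\<Sum>r\<in>R. 8 * ?D r) \<le> (\<Sum>r\<in>R. (?D r)\<^sup>2 + 16)"
    proof (rule sum_mono)
      fix r
      show "8 * ?D r \<le> (?D r)\<^sup>2 + 16"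
        using zero_le_power2[of "?D r - 4"] by (simp add: power2_diff)
    qed
    also have "\<dots> = real (\<Sum>r\<in>R. (card (N r \<inter> R))\<^sup>2) + 16 * (k + 1)"
      using cardR by (simp add: sum.distrib)
    also have "\<dots> \<le> real ((k + 1) * k) + 16 * (k + 1)"
      using R.sum_deg_squares cardR by (simp only: of_nat_le_iff add_le_cancel_right) simp
    finally have "8 * (\<Sum>r\<in>R. ?D r) \<le> (real k + 1) * (k + 16)"
      by (simp add: sum_distrib_left algebra_simps)
    moreover have "(\<Sum>r\<in>R. W r) = g * (2 * (\<Sum>r\<in>R. ?D r) + (k + 1))"
      by (simp add: W_def sum_distrib_left[symmetric] sum.distrib cardR)
    ultimately have "(\<Sum>r\<in>R. W r) \<le> g * ((real k + 1) * (k + 16) / 4 + (real k + 1))"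
      using g0 by (simp add: mult_left_mono)
    also have "\<dots> + g * (real k - 4) \<le> 1"
    proof -
      \<comment> \<open>Here \<open>k \<ge> 22\<close> enters: the two sides of the next inequality
        differ by this product plus 74.\<close>
      have "(real k - 22) * (3 * real k + 1) \<ge> 0" using k by simp
      then have "(real k + 1) * (k + 16) + 4 * (real k + 1) + 4 * (real k - 4) \<le> 4 * ((real k)\<^sup>2 - 10 * k + 14)"
        by (simp add: power2_eq_square algebra_simps)
      then have "(real k + 1) * (k + 16) / 4 + (real k + 1) + (real k - 4) \<le> (real k)\<^sup>2 - 10 * k + 14"
        by argo
      then have "g * ((real k + 1) * (k + 16) / 4 + (real k + 1) + (real k - 4))
          \<le> g * ((real k)\<^sup>2 - 10 * k + 14)"
        using g0 by simp
      also have "\<dots> = 1" using pos by (simp add: g_def)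
      finally show ?thesis by (simp only: distrib_left)
    qed
    finally have sum_W: "(\<Sum>r\<in>R. W r) + g * (real k - 4) \<le> 1" by simp
    \<comment> \<open>The first summands are known exactly by \<open>wA_eq\<close>. The excesses
      \<open>d a - 2\<close> over \<open>N v\<close> sum to at most 1, so the second summands cost
      at most \<open>g * (k - 4)\<close>.\<close>
    have "(lam - 2) * S = (\<Sum>a\<in>N v. (lam - d a) * wA a + (real (d a) - 2) * wA a)"
      unfolding S_def sum_distrib_left by (intro sum.cong) (auto simp: algebra_simps)
    also have "\<dots> = (\<Sum>a\<in>N v. 1 + (\<Sum>r\<in>N a - {v}. W r)) + (\<Sum>a\<in>N v. (real (d a) - 2) * wA a)"
      unfolding sum.distrib[symmetric] using wA_eq NA by (intro sum.cong) auto
    also have "(\<Sum>a\<in>N v. 1 + (\<Sum>r\<in>N a - {v}. W r)) = k + (\<Sum>r\<in>(\<Union>a\<in>N v. N a - {v}). W r)"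
      unfolding sum.distrib sum_nbrs_second[OF v] using dv by simp
    also have "(\<Sum>r\<in>(\<Union>a\<in>N v. N a - {v}). W r) \<le> (\<Sum>r\<in>R. W r)"
      using NA W0 finR by (intro sum_mono2) auto
    also have "(\<Sum>a\<in>N v. (real (d a) - 2) * wA a) \<le> (\<Sum>a\<in>N v. (real (d a) - 2) * (g * (real k - 4)))"
      using wA_le deg_ge2 nbr_in_V[OF v] by (intro sum_mono mult_left_mono) auto
    also have "\<dots> = (\<Sum>a\<in>N v. real (d a) - 2) * (g * (real k - 4))"
      by (simp add: sum_distrib_right)
    also have "\<dots> \<le> 1 * (g * (real k - 4))"
      using sum_excess[OF v] dv g0 k by (intro mult_right_mono) (auto simp: sum_subtractf)
    finally have "(lam - 2) * S \<le> k + 1" using sum_W by simp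
    also have "\<dots> < (lam - 2) * (lam - k)" using lam(2) by (simp add: mult.commute)
    finally show ?thesis using lam(1) k by simp
  qed
  obtain t where t: "t \<ge> 0" "t < 1" "S < (lam - k) * t"
    by (rule strict_scale[OF S0 \<open>S < lam - k\<close>])
  define w where "w u = (if u = v then t else if u \<in> N v then wA u else W u)" for u
  have wW: "(\<Sum>r\<in>M \<inter> R. w r) = (\<Sum>r\<in>M \<inter> R. W r)" for M
    using RV by (intro sum.cong) (auto simp: w_def)
  show False
  proof (rule no_subinvariant_if_strict_superharmonic[OF z])
    show "w u \<ge> 0" if "u \<in> V" for u using t wA0 W0 by (simp add: w_def)
    fix u assume "u \<in> V"
    then consider "u = v" | "u \<in> N v" | "u \<in> R" using V by blast
    then show "(\<Sum>s\<in>N u. w s) < (lam - d u) * w u"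
    proof cases
      case 1
      have "(\<Sum>s\<in>N v. w s) = S" unfolding S_def by (intro sum.cong) (auto simp: w_def)
      then show ?thesis using 1 t dv by (simp add: w_def)
    next
      case 2
      then have "u \<noteq> v" by auto
      have "(\<Sum>s\<in>N u. w s) = t + (\<Sum>r\<in>N u \<inter> R. W r)"
        unfolding sum_nbrs_remove[OF v 2] NA[OF 2] wW by (simp add: w_def)
      then show ?thesis using 2 t wA_eq[OF 2] \<open>u \<noteq> v\<close> by (simp add: w_def)
    next
      case 3
      then have u: "u \<in> V" "u \<noteq> v" "u \<notin> N v" using RV by auto
      have "(\<Sum>s\<in>N u. w s) = (\<Sum>s\<in>N u \<inter> N v. w s) + (\<Sum>r\<in>N u \<inter> R. W r)"
        using u RV wW[of "N u"] by (subst NR[OF 3], subst sum.union_disjoint) auto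
      moreover have "(\<Sum>r\<in>N u \<inter> R. W r) = g * (2 * (\<Sum>r\<in>N u \<inter> R. ?D r) + ?D u)"
        by (simp add: W_def sum_distrib_left[symmetric] sum.distrib)
      moreover have "\<dots> \<le> g * (2 * k + ?D u)"
        using g0 R_deg[OF 3] by simp
      moreover have "d u = card (N u \<inter> N v) + card (N u \<inter> R)"
        using u RV by (subst NR[OF 3], subst card_Un_disjoint) auto
      moreover have "(\<Sum>s\<in>N u \<inter> N v. w s) + g * (2 * k + ?D u) < (lam - d u) * w u"
        using NRA[OF 3]
      proof
        assume e: "N u \<inter> N v = {}"
        then have du: "real (d u) = ?D u" using calculation(4) by simp
        \<comment> \<open>With \<open>lam\<close> replaced by \<open>k + 1\<close> and
          \<open>g\<close> cancelled, the two sides differ by this product plus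
          \<open>k - 1\<close>.\<close>
        have "0 \<le> 2 * (?D u - 1) * (real k - 1 - ?D u)"
          using small[OF u(1,2)] deg_ge2[OF u(1)] du by (intro mult_nonneg_nonneg) auto
        then have "2 * k + ?D u < (real k + 1 - ?D u) * (2 * ?D u + 1)"
          using k by (simp add: algebra_simps)
        also have "\<dots> \<le> (lam - ?D u) * (2 * ?D u + 1)"
          using lam(1) by (intro mult_right_mono) auto
        finally have "g * (2 * k + ?D u) < g * ((lam - ?D u) * (2 * ?D u + 1))"
          using g0 by simp
        then show ?thesis using e u du by (simp add: w_def W_def mult_ac)
      next
        assume "\<exists>a. N u \<inter> N v = {a}"
        then obtain a where e: "N u \<inter> N v = {a}" by blast
        then have a: "a \<in> N v" "a \<noteq> v" by auto
        have du: "real (d u) = ?D u + 1" using calculation(4) e by simp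
        \<comment> \<open>Now the two sides, including the term \<open>k - 4\<close> for
          \<open>a\<close>, differ by exactly this product when \<open>lam\<close> is replaced by
          \<open>k + 1\<close>.\<close>
        have "0 \<le> 2 * (?D u - 1) * (real k - 2 - ?D u)"
          using small[OF u(1,2)] deg_ge2[OF u(1)] du by (intro mult_nonneg_nonneg) auto
        then have "(real k - 4) + (2 * k + ?D u) \<le> (real k + 1 - d u) * (2 * ?D u + 1)"
          using k du by (simp add: algebra_simps)
        also have "\<dots> < (lam - d u) * (2 * ?D u + 1)"
          using lam(1) by (intro mult_strict_right_mono) auto
        finally have "g * ((real k - 4) + (2 * k + ?D u)) < g * ((lam - d u) * (2 * ?D u + 1))"
          using g0 by simp
        then have "wA a + g * (2 * k + ?D u) < g * ((lam - d u) * (2 * ?D u + 1))"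
          using wA_le[OF a(1)] unfolding distrib_left[of g "real k - 4"] by linarith
        then show ?thesis using e a u by (simp add: w_def W_def mult_ac)
      qed
      ultimately show ?thesis by linarith
    qed
  qed
qed

end

subsection \<open>Two vertices of maximal degree\<close>

text \<open>The left sides are the sums of the test functions used for
  \<open>\<theta>(3\<^sup>k)\<close> and \<open>\<theta>(2,3\<^sup>k\<^sup>-\<^sup>2,4)\<close> over
  the neighbours of a vertex of degree \<open>k\<close>. Both stay below the corresponding sum for
  \<open>T_k\<close>.\<close>

lemma T_fraction_gt:
  fixes x :: real
  assumes k: "k \<ge> 22" and x: "x > k"
  shows "k / (x - 3) < T_fraction k x"
    and "2 / (x - 2) + (real k - 2) / (x - 3) + (1 + 3 / (x - 2)\<^sup>2) / (x - 2) < T_fraction k x"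
proof -
  define m where "m = x - 2"
  have m: "m > 20" using k x by (simp add: m_def)
  have xm: "x = m + 2" by (simp add: m_def)
  have "m * (m - 1) > 3 * 1" using m by (intro mult_strict_mono) auto
  then have Q: "m\<^sup>2 - m - 3 > 0" by (simp add: power2_eq_square algebra_simps)
  have T: "T_fraction k x = 2 / m + (real k - 3) / (m - 1) + (2 * m\<^sup>2 + m - 2) / (m * (m\<^sup>2 - m - 3))"
    unfolding T_fraction_def xm by (simp add: power2_eq_square algebra_simps)
  have "(2 * m\<^sup>2 + m - 2) / (m\<^sup>2 - m - 3) = 2 + (3 * m + 4) / (m\<^sup>2 - m - 3)"
    using Q by (simp add: field_simps)
  moreover have "(3 * m + 4) / (m\<^sup>2 - m - 3) > 3 / (m - 1)"
    using Q m by (simp add: divide_simps) (simp add: power2_eq_square algebra_simps)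
  ultimately have "(2 * m\<^sup>2 + m - 2) / (m\<^sup>2 - m - 3) / m > (2 + 3 / (m - 1)) / m"
    using m by (intro divide_strict_right_mono) auto
  \<comment> \<open>Replaces the last summand of \<open>T_fraction\<close> by fractions in
    \<open>m\<close> and \<open>m - 1\<close>, the denominators on the other side.\<close>
  then have frac: "(2 * m\<^sup>2 + m - 2) / (m * (m\<^sup>2 - m - 3)) > (2 + 3 / (m - 1)) / m"
    by (simp add: mult.commute)
  have split: "(real k - j) / (m - 1) = (real k - 3) / (m - 1) + (3 - j) / (m - 1)" for j
    by (simp add: diff_divide_distrib)
  have "3 / (m - 1) < 2 / m + (2 + 3 / (m - 1)) / m"
    using m by (simp add: divide_simps)
  then show "k / (x - 3) < T_fraction k x"
    unfolding T using frac split[of 0] xm by simp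
  have "1 / (m - 1) + 3 / m\<^sup>2 / m + 1 / m < (2 + 3 / (m - 1)) / m"
  proof -
    have "3 * (m - 1) < 2 * m * m" using m by (intro mult_strict_mono) auto
    then have "3 / m\<^sup>2 < 2 / (m - 1)" using m by (simp add: divide_simps power2_eq_square)
    then have "3 / m\<^sup>2 / m < 2 / (m - 1) / m" using m by (intro divide_strict_right_mono) auto
    moreover have "1 / (m - 1) = 1 / m + 1 / (m - 1) / m" using m by (simp add: divide_simps)
    ultimately show ?thesis using m by (simp add: add_divide_distrib)
  qed
  then show "2 / (x - 2) + (real k - 2) / (x - 3) + (1 + 3 / (x - 2)\<^sup>2) / (x - 2) < T_fraction k x"
    unfolding T using frac split[of 2] xm by (simp add: add_divide_distrib)
qed

text \<open>The arcs of \<open>T_graph\<close> in the form in which \<open>c34_free\<close> presents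
  a graph; \<open>parcs_T_graph\<close> proves the agreement.\<close>

fun T_nbrs :: "nat \<Rightarrow> theta_vertex \<Rightarrow> theta_vertex set" where
  "T_nbrs r TX = insert TM (TA ` {..<r - 1})"
| "T_nbrs r TY = insert TM (TB ` {..<r - 1})"
| "T_nbrs r TM = {TX, TY}"
| "T_nbrs r (TA i) = {TX, TB i} \<union> (if i = 0 then {TW} else {})"
| "T_nbrs r (TB i) = {TA i, TY} \<union> (if i = 1 then {TW} else {})"
| "T_nbrs r TW = {TA 0, TB 1}"

lemma card_le1E:
  assumes "finite S" "card S \<le> 1" "S \<noteq> {}"
  obtains s where "S = {s}"
  using assms by (metis One_nat_def card_1_singletonE card_gt_0_iff le_antisym Suc_leI)

section \<open>Two vertices of degree \<open>k\<close> without a common neighbour\<close>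

context c34_free_large
begin

lemma degree_k_nonadjacent:
  assumes "v \<in> V" "d v = k" "d y = k"
  shows "y \<notin> N v"
  using nbr_deg_bound[OF assms(1), of y] assms k by auto

text \<open>The two vertices and their \<open>2 * k\<close> neighbours already fill
  \<open>V\<close>. A neighbour \<open>a\<close> of \<open>v\<close> has no neighbour in
  \<open>N v\<close> and at most one in \<open>N y\<close>, and degree at least 2 forces that one.
  Hence the graph is \<open>\<theta>(3\<^sup>k)\<close>.\<close>

lemma disjoint_degree_k:
  assumes v: "v \<in> V" "d v = k" and y: "y \<in> V" "d y = k" and ne: "v \<noteq> y" and disj: "N v \<inter> N y = {}"
  shows "V = {v, y} \<union> N v \<union> N y" and "a \<in> N v \<Longrightarrow> \<exists>b\<in>N y. N a = {v, b}"
proof -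
  have nadj: "y \<notin> N v" "v \<notin> N y" using degree_k_nonadjacent v y by auto
  have "card ({v, y} \<union> (N v \<union> N y)) = card {v, y} + card (N v \<union> N y)"
    using v y nadj by (intro card_Un_disjoint) auto
  also have "card (N v \<union> N y) = 2 * k" using v y disj by (simp add: card_Un_disjoint)
  finally have "card ({v, y} \<union> N v \<union> N y) = card V" using ne card_V by (simp add: Un_assoc)
  moreover have "{v, y} \<union> N v \<union> N y \<subseteq> V" using v y nbr_in_V by auto
  ultimately show V: "V = {v, y} \<union> N v \<union> N y" using card_subset_eq[OF finite_V] by metis
  show "\<exists>b\<in>N y. N a = {v, b}" if a: "a \<in> N v"
  proof -
    have aV: "a \<in> V" "a \<noteq> y" using a v nbr_in_V nadj by auto
    have "v \<in> N a" "y \<notin> N a" using a nbrs_sym v aV disj by blast+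
    then have Na: "N a = insert v (N a \<inter> N y)"
      using V nbr_in_V[OF aV(1)] no_triangle[OF v(1) a] by blast
    have "N a \<inter> N y \<noteq> {}"
    proof
      assume e: "N a \<inter> N y = {}"
      have "N a = {v}" by (subst Na) (simp only: e)
      then show False using deg_ge2[OF aV(1)] by simp
    qed
    then obtain b where "N a \<inter> N y = {b}"
      using card_le1E[of "N a \<inter> N y"] card_common_nbrs[OF aV(1) y(1) aV(2)] aV by auto
    then show ?thesis using Na by blast
  qed
qed

lemma common_nbr_if_subinvariant:
  assumes z: "subinvariant lam z"
    and v: "v \<in> V" "d v = k" and y: "y \<in> V" "d y = k" and ne: "v \<noteq> y"
  shows "N v \<inter> N y \<noteq> {}"
proof
  assume disj: "N v \<inter> N y = {}"
  note vy = disjoint_degree_k[OF v y ne disj]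
  have disj': "N y \<inter> N v = {}" using disj by blast
  note yv = disjoint_degree_k[OF y v ne[symmetric] disj']
  have nadj: "y \<notin> N v" "v \<notin> N y" using degree_k_nonadjacent v y by auto
  \<comment> \<open>Solves \<open>(lam - 2) * p = 1 + p\<close>, the equation inside a path of
    length 3 with value 1 at its ends.\<close>
  define p where "p = 1 / (lam - 3)"
  have p: "p > 0" "(lam - 2) * p = 1 + p" using lam(1) k by (auto simp: p_def field_simps)
  have "k * p < lam - k"
    using T_fraction_gt(1)[OF k lam_gt_k] lam_T by (simp add: p_def)
  then obtain t where t: "0 \<le> t" "t < 1" "k * p < (lam - k) * t"
    using p strict_scale[of "k * p" "lam - k"] by auto
  define w where "w u = (if u = v \<or> u = y then t else p)" for u
  show False
  proof (rule no_subinvariant_if_strict_superharmonic[OF z])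
    show "w u \<ge> 0" for u using t p by (simp add: w_def)
    fix u assume "u \<in> V"
    then consider "u = v" | "u = y" | "u \<in> N v" | "u \<in> N y" using vy(1) by blast
    then show "(\<Sum>s\<in>N u. w s) < (lam - d u) * w u"
    proof cases
      case 1
      have "(\<Sum>s\<in>N v. w s) = (\<Sum>s\<in>N v. p)" using nadj by (intro sum.cong) (auto simp: w_def)
      then show ?thesis using 1 t v by (simp add: w_def)
    next
      case 2
      have "(\<Sum>s\<in>N y. w s) = (\<Sum>s\<in>N y. p)" using nadj by (intro sum.cong) (auto simp: w_def)
      then show ?thesis using 2 t y by (simp add: w_def)
    next
      case 3
      from vy(2)[OF 3] obtain b where b: "b \<in> N y" "N u = {v, b}" by (rule bexE)
      have "b \<noteq> v" "b \<noteq> y" using b(1) nadj by auto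
      moreover have "u \<noteq> v" "u \<noteq> y" using 3 nadj by auto
      moreover have "v \<noteq> b" "y \<noteq> b" using calculation by simp_all
      ultimately show ?thesis using t p unfolding b(2) w_def by simp
    next
      case 4
      from yv(2)[OF 4] obtain b where b: "b \<in> N v" "N u = {y, b}" by (rule bexE)
      have "b \<noteq> v" "b \<noteq> y" using b(1) nadj by auto
      moreover have "u \<noteq> v" "u \<noteq> y" using 4 nadj by auto
      moreover have "v \<noteq> b" "y \<noteq> b" using calculation by simp_all
      ultimately show ?thesis using t p unfolding b(2) w_def by simp
    qed
  qed
qed

end

section \<open>Two vertices of degree \<open>k\<close> with a common neighbour \<open>m\<close>, and
  the one vertex \<open>x\<close> left over\<close>

locale c34_free_two_hubs = c34_free_large +
  fixes v y m x :: 'a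
  assumes v: "v \<in> V" "d v = k" and y: "y \<in> V" "d y = k" and v_ne_y: "v \<noteq> y"
    and m: "m \<in> N v" "m \<in> N y"
    and V_eq: "V = {v, y, x} \<union> N v \<union> N y"
    and x: "x \<notin> N v" "x \<notin> N y" "x \<noteq> v" "x \<noteq> y"
begin

text \<open>Interpreting the locale with \<open>v\<close> and \<open>y\<close> exchanged turns each
  fact about \<open>A\<close> into its mirror image about \<open>B\<close>.\<close>

lemma swap: "c34_free_two_hubs V N k lam y v m x"
  using v y v_ne_y m V_eq x by unfold_locales auto

abbreviation A where "A \<equiv> N v - {m}"
abbreviation B where "B \<equiv> N y - {m}"

lemma nonadjacent: "y \<notin> N v" "v \<notin> N y" using degree_k_nonadjacent v y by auto

lemma common: "a \<in> N v \<Longrightarrow> a \<in> N y \<Longrightarrow> a = m"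
  using no_4_cycle[OF v(1) y(1) v_ne_y, of a m] m by blast

lemma card_A: "card A = k - 1" using v m by simp

lemma xV: "x \<in> V" using V_eq by blast

text \<open>As \<open>x\<close> shares at most one neighbour with each of \<open>v\<close> and
  \<open>y\<close>, degree at least 2 forces exactly one on each side, and these are distinct; so
  neither is \<open>m\<close>.\<close>

lemma N_x: obtains a0 b1 where "a0 \<in> A" "b1 \<in> B" "N x = {a0, b1}"
proof -
  have c: "card (N x \<inter> N v) \<le> 1" "card (N x \<inter> N y) \<le> 1"
    using card_common_nbrs xV v y x by auto
  have "v \<notin> N x" "y \<notin> N x" using nbrs_sym[OF xV] x by auto
  then have Nx: "N x = (N x \<inter> N v) \<union> (N x \<inter> N y)" using V_eq nbr_in_V[OF xV] nbrs_irrefl[of x] by blast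
  have "2 \<le> card ((N x \<inter> N v) \<union> (N x \<inter> N y))" using deg_ge2[OF xV] unfolding Nx[symmetric] .
  moreover have "card ((N x \<inter> N v) \<union> (N x \<inter> N y)) + card ((N x \<inter> N v) \<inter> (N x \<inter> N y))
      = card (N x \<inter> N v) + card (N x \<inter> N y)"
    using xV by (intro card_Un_Int[symmetric]) auto
  ultimately have "card (N x \<inter> N v) = 1" "card (N x \<inter> N y) = 1"
    "card ((N x \<inter> N v) \<inter> (N x \<inter> N y)) = 0" using c by linarith+
  then obtain a0 b1 where e: "N x \<inter> N v = {a0}" "N x \<inter> N y = {b1}" "a0 \<noteq> b1"
    by (auto simp: card_1_singleton_iff)
  have "m \<notin> N x" using e m by (metis IntI singletonD)
  moreover have "a0 \<in> N x \<inter> N v" "b1 \<in> N x \<inter> N y" using e by simp_all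
  ultimately have "a0 \<in> A" "b1 \<in> B" by auto
  moreover have "N x = {a0, b1}" by (subst Nx) (simp add: e insert_commute)
  ultimately show ?thesis by (rule that)
qed

lemma N_m: "N m = {v, y}"
proof -
  have mV: "m \<in> V" using m v nbr_in_V by blast
  obtain a0 b1 where "a0 \<in> A" "b1 \<in> B" "N x = {a0, b1}" by (rule N_x)
  then have "x \<notin> N m" using nbrs_sym[OF mV, of x] by auto
  moreover have "N m \<inter> N v = {}" "N m \<inter> N y = {}" using no_triangle m v y by blast+
  moreover have "v \<in> N m" "y \<in> N m" using m v y nbrs_sym by blast+
  ultimately show ?thesis using V_eq nbr_in_V[OF mV] by auto
qed

lemma N_A:
  assumes a: "a \<in> A"
  shows "N a = {v} \<union> (N a \<inter> B) \<union> (N a \<inter> {x})" and "card (N a \<inter> B) \<le> 1"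
    and "a \<notin> N x \<Longrightarrow> \<exists>b. N a \<inter> B = {b}"
proof -
  have aV: "a \<in> V" "a \<noteq> y" using a v nbr_in_V nonadjacent by auto
  have "y \<notin> N a" using nbrs_sym[OF aV(1), of y] common a by auto
  moreover have "m \<notin> N a" using N_m nbrs_sym[OF aV(1), of m] a nonadjacent by auto
  moreover have "v \<in> N a" using nbrs_sym v a by blast
  ultimately show Na: "N a = {v} \<union> (N a \<inter> B) \<union> (N a \<inter> {x})"
    using V_eq nbr_in_V[OF aV(1)] no_triangle[OF v(1), of a] a by blast
  have "card (N a \<inter> B) \<le> card (N a \<inter> N y)" using aV by (intro card_mono) auto
  then show c: "card (N a \<inter> B) \<le> 1" using card_common_nbrs[OF aV(1) y(1) aV(2)] by simp
  assume "a \<notin> N x"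
  then have Na': "N a = insert v (N a \<inter> B)" using Na nbrs_sym[OF aV(1), of x] by blast
  have "N a \<inter> B \<noteq> {}"
  proof
    assume e: "N a \<inter> B = {}"
    have "N a = {v}" by (subst Na') (simp only: e)
    then show False using deg_ge2[OF aV(1)] by simp
  qed
  then show "\<exists>b. N a \<inter> B = {b}" using c aV card_le1E[of "N a \<inter> B"] by auto
qed

text \<open>Double counting of the edges between \<open>A\<close> and \<open>B\<close>:
  \<open>sum_nbrs_swap\<close> for the two indicator functions.\<close>

lemma card_A_B_edges: "(\<Sum>a\<in>A. card (N a \<inter> B)) = (\<Sum>b\<in>B. card (N b \<inter> A))"
proof -
  have ind: "(\<Sum>u\<in>V. of_bool (u \<in> P) * (\<Sum>s\<in>N u. of_bool (s \<in> Q))) = (\<Sum>a\<in>P. card (N a \<inter> Q))"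
    if "P \<subseteq> V" for P Q :: "'a set"
  proof -
    have "(\<Sum>u\<in>V. of_bool (u \<in> P) * (\<Sum>s\<in>N u. of_bool (s \<in> Q)))
      = (\<Sum>u\<in>V. if u \<in> P then card (N u \<inter> Q) else 0)"
      by (intro sum.cong) (auto simp: sum.inter_restrict[symmetric] of_bool_def)
    also have "\<dots> = (\<Sum>a\<in>P. card (N a \<inter> Q))"
      using that by (simp add: sum.inter_restrict[symmetric] Int_absorb1)
    finally show ?thesis .
  qed
  have "A \<subseteq> V" "B \<subseteq> V" using v y nbr_in_V by auto
  then show ?thesis
    unfolding ind[OF \<open>A \<subseteq> V\<close>, symmetric] ind[OF \<open>B \<subseteq> V\<close>, symmetric] by (intro sum_nbrs_swap)
qed

end

abbreviation T_verts :: "nat \<Rightarrow> theta_vertex set" where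
  "T_verts r \<equiv> insert TW (theta_verts r)"

context c34_free_two_hubs
begin

lemma A_B_disjoint: "a \<in> A \<Longrightarrow> a \<notin> N y" "b \<in> B \<Longrightarrow> b \<notin> N v"
  using common by auto

lemma sum_A_edges:
  assumes "a0 \<in> A" "b1 \<in> B" "N x = {a0, b1}"
  shows "(\<Sum>a\<in>A. card (N a \<inter> B)) = card (N a0 \<inter> B) + (k - 2)"
proof -
  have fin: "finite A" using v by simp
  have "(\<Sum>a\<in>A - {a0}. card (N a \<inter> B)) = (\<Sum>a\<in>A - {a0}. 1)"
  proof (rule sum.cong)
    fix a assume a: "a \<in> A - {a0}"
    then have "a \<notin> N x" using assms(2,3) A_B_disjoint(1)[of a] by auto
    then obtain b where "N a \<inter> B = {b}" using N_A(3)[of a] a by blast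
    then show "card (N a \<inter> B) = 1" by simp
  qed simp
  also have "\<dots> = k - 2" using fin assms(1) card_A by simp
  finally show ?thesis using fin assms(1) by (simp add: sum.remove)
qed

text \<open>Every vertex of \<open>A\<close> except possibly \<open>a0\<close> has exactly one
  neighbour in \<open>B\<close>, and likewise for \<open>b1\<close> in \<open>B\<close>, so
  comparing the two edge counts isolates these vertices. Two graphs remain, according to whether
  \<open>a0\<close> has a neighbour in \<open>B\<close>.\<close>

lemma card_edge_a0_b1:
  assumes "a0 \<in> A" "b1 \<in> B" "N x = {a0, b1}"
  shows "card (N a0 \<inter> B) = card (N b1 \<inter> A)"
proof -
  interpret S: c34_free_two_hubs V N k lam y v m x by (rule swap)
  have "N x = {b1, a0}" using assms(3) by auto
  then show ?thesis
    using sum_A_edges[OF assms] S.sum_A_edges[of b1 a0] assms card_A_B_edges by simp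
qed

lemma nbrs_of_path_vertex:
  assumes "a0 \<in> A" "b1 \<in> B" "N x = {a0, b1}" "N b1 \<inter> A = {}" and a: "a \<in> A" "a \<noteq> a0"
  shows "\<exists>b\<in>B. b \<noteq> b1 \<and> N a = {v, b}"
proof -
  have aV: "a \<in> V" using a v nbr_in_V by auto
  have ax: "a \<notin> N x" using assms(2,3) a A_B_disjoint(1)[of a] by auto
  then obtain b where b: "N a \<inter> B = {b}" using N_A(3)[OF a(1)] by blast
  have "x \<notin> N a" using ax nbrs_sym[OF aV, of x] by auto
  then have "N a = {v} \<union> {b}" by (subst N_A(1)[OF a(1)]) (simp add: b)
  moreover have bB: "b \<in> B" "b \<in> N a" using b by auto
  moreover have "b \<noteq> b1" using nbrs_sym[OF aV bB(2)] assms(4) a by auto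
  ultimately show ?thesis by auto
qed

text \<open>Otherwise the graph is \<open>\<theta>(2,3\<^sup>k\<^sup>-\<^sup>2,4)\<close>, with
  \<open>v\<close>, \<open>a0\<close>, \<open>x\<close>, \<open>b1\<close>, \<open>y\<close> as its
  path of length 4, and a test function excludes it.\<close>

lemma edge_if_subinvariant:
  assumes z: "subinvariant lam z"
    and ab: "a0 \<in> A" "b1 \<in> B" and Nx: "N x = {a0, b1}"
  shows "N a0 \<inter> B \<noteq> {}"
proof
  assume Na0: "N a0 \<inter> B = {}"
  interpret S: c34_free_two_hubs V N k lam y v m x by (rule swap)
  have Nx': "N x = {b1, a0}" using Nx by auto
  have "finite (N b1 \<inter> A)" using v by simp
  then have Nb1: "N b1 \<inter> A = {}" using card_edge_a0_b1[OF ab Nx] Na0 by simp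
  have mem: "a0 \<in> V" "b1 \<in> V" "m \<in> V" using ab v y m nbr_in_V by auto
  have dist: "v \<noteq> m" "y \<noteq> m" "x \<noteq> m" "x \<noteq> a0" "x \<noteq> b1" "v \<noteq> a0" "v \<noteq> b1" "y \<noteq> a0" "y \<noteq> b1"
    "a0 \<noteq> b1" "m \<noteq> a0" "m \<noteq> b1"
    using m x ab v y nonadjacent A_B_disjoint(1)[of a0] by auto
  define mu where "mu = lam - 2"
  have mu: "mu > 20" using lam(1) k by (simp add: mu_def)
  \<comment> \<open>With value 1 at \<open>v\<close> and \<open>y\<close>, \<open>p\<close> and
    \<open>q\<close> solve the equations on the paths of length 3 and at \<open>a0\<close>,
    \<open>b1\<close>. The value \<open>s\<close> at \<open>x\<close> lies above the exact solution
    \<open>2 / (mu\<^sup>2 - 2)\<close>, which makes the inequality at \<open>x\<close>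
    strict.\<close>
  define s where "s = 3 / mu\<^sup>2"
  define p where "p = 1 / (lam - 3)"
  define q where "q = (1 + s) / mu"
  have p: "p > 0" "mu * p = 1 + p" using lam(1) k by (auto simp: p_def mu_def field_simps)
  have s: "s > 0" using mu by (simp add: s_def)
  have q: "q > 0" "mu * q = 1 + s" using mu s by (auto simp: q_def)
  have qs: "2 * q < mu * s"
  proof -
    have "2 * 3 < mu * mu" using mu by (intro mult_strict_mono) auto
    then have "2 * (1 + 3 / mu\<^sup>2) < 3" using mu by (simp add: field_simps power2_eq_square)
    then have "2 * (1 + s) / mu < 3 / mu"
      unfolding s_def using mu by (intro divide_strict_right_mono) auto
    then show ?thesis using mu by (simp add: q_def s_def power2_eq_square)
  qed
  define S where "S = 2 / mu + (real k - 2) * p + q"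
  have "S \<ge> 0" using mu p q k by (auto simp: S_def)
  moreover have "S < lam - k"
    using T_fraction_gt(2)[OF k lam_gt_k] lam_T unfolding S_def p_def q_def s_def mu_def by simp
  ultimately obtain t where t: "0 \<le> t" "t < 1" "S < (lam - k) * t" by (rule strict_scale)
  define w where "w u = (if u = v \<or> u = y then t else if u = m then 2 / mu else if u = x then s
    else if u = a0 \<or> u = b1 then q else p)" for u
  have wv: "w v = t" "w y = t" and wm: "w m = 2 / mu" and wx: "w x = s" and wa: "w a0 = q" "w b1 = q"
    using dist x by (auto simp: w_def)
  have wp: "w u = p" if "u \<in> A \<and> u \<noteq> a0 \<or> u \<in> B \<and> u \<noteq> b1" for u
  proof -
    have "u \<noteq> v" "u \<noteq> y" "u \<noteq> m" "u \<noteq> x" using that x nonadjacent by auto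
    moreover have "u \<noteq> a0" "u \<noteq> b1"
      using that ab A_B_disjoint(1)[of u] A_B_disjoint(2)[of u] by blast+
    ultimately show ?thesis by (simp add: w_def)
  qed
  have hub: "(\<Sum>s\<in>N h. w s) = S"
    if h: "h \<in> V" "d h = k" "m \<in> N h" "c \<in> N h - {m}" "w c = q" "\<And>s. s \<in> N h - {m} - {c} \<Longrightarrow> w s = p"
    for h c
  proof -
    have "(\<Sum>s\<in>N h. w s) = w m + (w c + (\<Sum>s\<in>N h - {m} - {c}. w s))"
      using h by (subst sum.remove[of "N h" m], simp, simp, subst sum.remove[of "N h - {m}" c]) auto
    also have "(\<Sum>s\<in>N h - {m} - {c}. w s) = (\<Sum>s\<in>N h - {m} - {c}. p)"
      using h(6) by (rule sum.cong[OF refl])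
    also have "\<dots> = (real k - 2) * p" using h k by (simp add: of_nat_diff)
    finally show ?thesis using h(5) wm by (simp add: S_def)
  qed
  show False
  proof (rule no_subinvariant_if_strict_superharmonic[OF z])
    show "w u \<ge> 0" for u using t p q s mu by (simp add: w_def)
    have "(\<Sum>s\<in>N u. w s) < mu * w u \<and> d u = 2" if u: "u = m \<or> u = x \<or> u \<in> A \<or> u \<in> B" for u
    proof -
      consider "u = m" | "u = x" | "u = a0" | "u = b1" | "u \<in> A" "u \<noteq> a0" | "u \<in> B" "u \<noteq> b1"
        using u by blast
      then show ?thesis
      proof cases
        case 1
        then show ?thesis using N_m v_ne_y t wv wm mu by simp
      next
        case 2
        then show ?thesis using Nx dist wa wx qs by simp
      next
        case 3
        have "x \<in> N a0" using nbrs_sym[OF xV] Nx by auto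
        then have "N a0 = {v, x}" using N_A(1)[OF ab(1)] Na0 by auto
        then show ?thesis using 3 x wv wx wa q t by simp
      next
        case 4
        have "x \<in> N b1" using nbrs_sym[OF xV] Nx by auto
        then have "N b1 = {y, x}" using S.N_A(1)[OF ab(2)] Nb1 by auto
        then show ?thesis using 4 x wv wx wa q t by simp
      next
        case 5
        obtain b where b: "b \<in> B" "b \<noteq> b1" "N u = {v, b}"
          using nbrs_of_path_vertex[OF ab Nx Nb1 5] by (elim bexE conjE)
        then have "v \<noteq> b" using nonadjacent by auto
        then show ?thesis using b(3) wv wp[of b] wp[of u] b(1,2) 5 p t by simp
      next
        case 6
        obtain b where b: "b \<in> A" "b \<noteq> a0" "N u = {y, b}"
          using S.nbrs_of_path_vertex[OF ab(2,1) Nx' Na0 6] by (elim bexE conjE)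
        then have "y \<noteq> b" using nonadjacent by auto
        then show ?thesis using b(3) wv wp[of b] wp[of u] b(1,2) 6 p t by simp
      qed
    qed
    note path = this
    fix u assume "u \<in> V"
    then consider "u = v" | "u = y" | "u = m \<or> u = x \<or> u \<in> A \<or> u \<in> B" using V_eq by blast
    then show "(\<Sum>s\<in>N u. w s) < (lam - d u) * w u"
    proof cases
      case 1
      have "(\<Sum>s\<in>N v. w s) = S" using v m ab wa wp by (intro hub[of v a0]) auto
      then show ?thesis using 1 t wv v by simp
    next
      case 2
      have "(\<Sum>s\<in>N y. w s) = S" using y m ab wa wp by (intro hub[of y b1]) auto
      then show ?thesis using 2 t wv y by simp
    next
      case 3
      then show ?thesis using path[OF 3] by (simp add: mu_def)
    qed
  qed
qed

text \<open>The edges between \<open>A\<close> and \<open>B\<close> now form a perfect matching,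
  given by \<open>pa\<close> and \<open>pb\<close>, whose pairs are the inner vertices of the paths
  of length 3. The neighbours \<open>a0\<close> and \<open>b1\<close> of \<open>x\<close> lie on
  different paths, since an edge between them would close a triangle.\<close>

lemma T_if_edge:
  assumes ab: "a0 \<in> A" "b1 \<in> B" and Nx: "N x = {a0, b1}" and edge: "N a0 \<inter> B \<noteq> {}"
  shows "\<exists>f. bij_betw f (T_verts k) V \<and> (\<forall>t\<in>T_verts k. N (f t) = f ` T_nbrs k t)"
proof -
  interpret S: c34_free_two_hubs V N k lam y v m x by (rule swap)
  have Nx': "N x = {b1, a0}" using Nx by auto
  have finA: "finite A" and finB: "finite B" using v y by simp_all
  have "finite (N b1 \<inter> A)" "finite (N a0 \<inter> B)" using finA finB by simp_all
  then have edge': "N b1 \<inter> A \<noteq> {}" using card_edge_a0_b1[OF ab Nx] edge by fastforce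
  have "\<exists>b. N a \<inter> B = {b}" if a: "a \<in> A" for a
  proof (cases "a = a0")
    case True
    then show ?thesis using edge N_A(2)[OF a] finB card_le1E[of "N a \<inter> B"] by auto
  next
    case False
    then have "a \<notin> N x" using Nx ab(2) A_B_disjoint(1)[OF a] by auto
    then show ?thesis by (rule N_A(3)[OF a])
  qed
  then obtain pa where pa: "\<And>a. a \<in> A \<Longrightarrow> N a \<inter> B = {pa a}" by metis
  have "\<exists>a. N b \<inter> A = {a}" if b: "b \<in> B" for b
  proof (cases "b = b1")
    case True
    then show ?thesis using edge' S.N_A(2)[OF b] finA card_le1E[of "N b \<inter> A"] by auto
  next
    case False
    then have "b \<notin> N x" using Nx ab(1) A_B_disjoint(2)[OF b] by auto
    then show ?thesis by (rule S.N_A(3)[OF b])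
  qed
  then obtain pb where pb: "\<And>b. b \<in> B \<Longrightarrow> N b \<inter> A = {pb b}" by metis
  have AV: "A \<subseteq> V" and BV: "B \<subseteq> V" using v y nbr_in_V by auto
  have pa_in: "pa a \<in> B" "pa a \<in> N a" if "a \<in> A" for a using pa[OF that] by auto
  have pb_in: "pb b \<in> A" "pb b \<in> N b" if "b \<in> B" for b using pb[OF that] by auto
  have pb_pa: "pb (pa a) = a" if "a \<in> A" for a
  proof -
    have "a \<in> N (pa a) \<inter> A"
      using nbrs_sym[OF subsetD[OF AV that] pa_in(2)[OF that]] that by (rule IntI)
    then show ?thesis unfolding pb[OF pa_in(1)[OF that]] by simp
  qed
  have pa_pb: "pa (pb b) = b" if "b \<in> B" for b
  proof -
    have "b \<in> N (pb b) \<inter> B"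
      using nbrs_sym[OF subsetD[OF BV that] pb_in(2)[OF that]] that by (rule IntI)
    then show ?thesis unfolding pa[OF pb_in(1)[OF that]] by simp
  qed
  have pa_A: "pa ` A = B" using pa_in(1) pb_in(1) pa_pb by force
  define a1 where "a1 = pb b1"
  have a1: "a1 \<in> A" "pa a1 = b1" using pb_in[OF ab(2)] pa_pb[OF ab(2)] by (auto simp: a1_def)
  have "a0 \<in> N x" "b1 \<in> N x" using Nx by auto
  then have "b1 \<notin> N a0" using no_triangle[OF xV] by blast
  then have ne: "a1 \<noteq> a0" using a1 pa_in(2) by metis
  have "card (A - {a0, a1}) = k - 3"
    using finA card_A ab a1 ne by (simp add: card_Diff_subset)
  then obtain g where g: "bij_betw g {..<k - 3} (A - {a0, a1})"
    using finA ex_bij_betw_nat_finite[of "A - {a0, a1}"] by (metis atLeast0LessThan finite_Diff)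
  \<comment> \<open>Numbers the paths so that those through \<open>a0\<close> and \<open>b1\<close>
    get the indices 0 and 1 used in \<open>T_graph\<close>.\<close>
  define e where "e i = (if i = 0 then a0 else if i = 1 then a1 else g (i - 2))" for i :: nat
  have e01: "e 0 = a0" "e 1 = a1" by (auto simp: e_def)
  have "{..<k - 1} = {0, 1} \<union> (\<lambda>i. i + 2) ` {..<k - 3}"
  proof (intro equalityI subsetI)
    fix i assume i: "i \<in> {..<k - 1}"
    show "i \<in> {0, 1} \<union> (\<lambda>i. i + 2) ` {..<k - 3}"
    proof (cases "i < 2")
      case False
      then have "i = (i - 2) + 2" "i - 2 \<in> {..<k - 3}" using i by auto
      then show ?thesis by blast
    qed auto
  qed (use k in auto)
  moreover have "e ` (\<lambda>i. i + 2) ` {..<k - 3} = g ` {..<k - 3}"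
    unfolding image_image by (simp add: e_def)
  moreover have "e ` {0, 1} = {a0, a1}" using e01 by simp
  ultimately have "e ` {..<k - 1} = {a0, a1} \<union> g ` {..<k - 3}"
    by (simp only: image_Un)
  also have "\<dots> = A" using g ab a1 by (auto simp: bij_betw_def)
  finally have e_A: "e ` {..<k - 1} = A" .
  then have "inj_on e {..<k - 1}" using card_A by (intro eq_card_imp_inj_on) auto
  then have e_eq: "e i = e j \<longleftrightarrow> i = j" if "i < k - 1" "j < k - 1" for i j
    using that by (auto simp: inj_on_def)
  have e_in: "e i \<in> A" if "i < k - 1" for i using e_A that by blast
  define f where "f t = (case t of TX \<Rightarrow> v | TY \<Rightarrow> y | TM \<Rightarrow> m | TW \<Rightarrow> x
    | TA i \<Rightarrow> e i | TB i \<Rightarrow> pa (e i))" for t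
  have f_simps [simp]: "f TX = v" "f TY = y" "f TM = m" "f TW = x" "\<And>i. f (TA i) = e i"
    "\<And>i. f (TB i) = pa (e i)" by (auto simp: f_def)
  have fA: "f ` TA ` {..<k - 1} = A" and fB: "f ` TB ` {..<k - 1} = B"
    using e_A pa_A by (simp_all add: image_image flip: image_image[of pa e])
  have Nvy: "N v = insert m A" "N y = insert m B" using m by auto
  have f_V: "f ` T_verts k = V"
    unfolding theta_verts_def image_insert image_Un fA fB f_simps by (subst V_eq) (use m in blast)
  \<comment> \<open>Injectivity of \<open>f\<close> comes from counting, as \<open>f\<close> maps
    onto \<open>V\<close>, which has \<open>2 * k + 2\<close> elements.\<close>
  have "card (T_verts k) \<le> 2 * k + 2"
  proof -
    have "card (TA ` {..<k - 1}) \<le> k - 1" "card (TB ` {..<k - 1}) \<le> k - 1"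
      using card_image_le[of "{..<k - 1}"] by (metis card_lessThan finite_lessThan)+
    moreover have "card ({TX, TY, TM} \<union> TA ` {..<k - 1} \<union> TB ` {..<k - 1})
        \<le> card {TX, TY, TM} + card (TA ` {..<k - 1}) + card (TB ` {..<k - 1})"
      by (meson add_le_mono1 card_Un_le le_trans)
    moreover have "card {TX, TY, TM} = 3" by simp
    moreover have "card (T_verts k) \<le> Suc (card (theta_verts k))"
      by (simp add: card_insert_if theta_verts_def)
    ultimately show ?thesis using k unfolding theta_verts_def by linarith
  qed
  moreover have fin: "finite (T_verts k)" by (simp add: theta_verts_def)
  ultimately have "card (f ` T_verts k) = card (T_verts k)"
    using card_image_le[OF fin, of f] f_V card_V by simp
  then have "inj_on f (T_verts k)" by (rule eq_card_imp_inj_on[OF fin])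
  then have "bij_betw f (T_verts k) V" using f_V by (simp add: bij_betw_def)
  moreover have "N (f t) = f ` T_nbrs k t" if "t \<in> T_verts k" for t
  proof -
    have k1: "0 < k - 1" "1 < k - 1" using k by auto
    from that consider "t = TX" | "t = TY" | "t = TM" | "t = TW" | i where "t = TA i" "i < k - 1" | i where "t = TB i" "i < k - 1"
      by (auto simp: theta_verts_def)
    then show ?thesis
    proof cases
      case 1
      show ?thesis unfolding 1 T_nbrs.simps image_insert fA f_simps by (rule Nvy(1))
    next
      case 2
      show ?thesis unfolding 2 T_nbrs.simps image_insert fB f_simps by (rule Nvy(2))
    next
      case 3
      then show ?thesis using N_m by simp
    next
      case 4
      then show ?thesis using Nx e01 a1 by simp
    next
      case 5
      have a: "e i \<in> A" by (rule e_in[OF 5(2)])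
      have "x \<in> N (e i) \<longleftrightarrow> e i \<in> N x"
        using nbrs_sym[OF xV] nbrs_sym[OF subsetD[OF AV a]] by blast
      also have "\<dots> \<longleftrightarrow> e i = a0" using Nx ab(2) A_B_disjoint(1)[OF a] by auto
      also have "\<dots> \<longleftrightarrow> i = 0" using e_eq[OF 5(2) k1(1)] e01 by simp
      finally have "N (e i) \<inter> {x} = (if i = 0 then {x} else {})" by auto
      then show ?thesis unfolding 5(1) f_simps
        by (subst N_A(1)[OF a]) (simp add: pa[OF a] insert_commute)
    next
      case 6
      have a: "e i \<in> A" by (rule e_in[OF 6(2)])
      have b: "pa (e i) \<in> B" by (rule pa_in(1)[OF a])
      have "x \<in> N (pa (e i)) \<longleftrightarrow> pa (e i) \<in> N x"
        using nbrs_sym[OF xV] nbrs_sym[OF subsetD[OF BV b]] by blast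
      also have "\<dots> \<longleftrightarrow> pa (e i) = pa a1" using Nx ab(1) A_B_disjoint(2)[OF b] a1(2) by auto
      also have "\<dots> \<longleftrightarrow> e i = e 1" using pb_pa a a1 e01 by metis
      also have "\<dots> \<longleftrightarrow> i = 1" using e_eq[OF 6(2) k1(2)] by simp
      finally have "N (pa (e i)) \<inter> {x} = (if i = 1 then {x} else {})" by auto
      then show ?thesis unfolding 6(1) f_simps
        by (subst S.N_A(1)[OF b]) (simp add: pb[OF b] pb_pa[OF a] insert_commute)
    qed
  qed
  ultimately show ?thesis by (intro exI[of _ f]) simp
qed

end

text \<open>The exclusions so far give two vertices of degree \<open>k\<close> with a common
  neighbour. Together with their neighbourhoods they cover \<open>2 * k + 1\<close> vertices, so
  exactly one vertex \<open>x\<close> is left.\<close>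

lemma (in c34_free_large) T_if_subinvariant:
  assumes z: "subinvariant lam z"
  shows "\<exists>f. bij_betw f (T_verts k) V \<and> (\<forall>t\<in>T_verts k. N (f t) = f ` T_nbrs k t)"
proof -
  obtain v where v: "v \<in> V" "d v = k" using degree_k_if_subinvariant[OF z] by blast
  obtain y where y: "y \<in> V" "d y = k" and ne: "v \<noteq> y"
    using second_degree_k_if_subinvariant[OF z v] by blast
  obtain m where m: "m \<in> N v" "m \<in> N y"
    using common_nbr_if_subinvariant[OF z v y ne] by blast
  have nadj: "y \<notin> N v" "v \<notin> N y" using degree_k_nonadjacent v y by auto
  have "N v \<inter> N y = {m}" using m no_4_cycle[OF v(1) y(1) ne, of m] by blast
  then have "card (N v \<union> N y) + 1 = 2 * k"
    using card_Un_Int[of "N v" "N y"] v y by simp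
  moreover have "card ({v, y} \<union> (N v \<union> N y)) = card {v, y} + card (N v \<union> N y)"
    using v y nadj by (intro card_Un_disjoint) auto
  ultimately have "card ({v, y} \<union> (N v \<union> N y)) = 2 * k + 1" using ne by simp
  moreover have sub: "{v, y} \<union> (N v \<union> N y) \<subseteq> V" using v y nbr_in_V by auto
  ultimately have "card (V - ({v, y} \<union> (N v \<union> N y))) = 1"
    using card_V v by (subst card_Diff_subset) (auto intro: finite_subset[OF sub])
  then obtain x where x: "V - ({v, y} \<union> (N v \<union> N y)) = {x}" by (auto simp: card_1_singleton_iff)
  have "x \<in> V - ({v, y} \<union> (N v \<union> N y))" using x by simp
  then have x_notin: "x \<notin> N v" "x \<notin> N y" "x \<noteq> v" "x \<noteq> y" by simp_all
  have V_eq: "V = {v, y, x} \<union> N v \<union> N y" using x sub by blast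
  interpret c34_free_two_hubs V N k lam v y m x
    by (intro c34_free_two_hubs.intro c34_free_two_hubs_axioms.intro c34_free_large_axioms
      v y ne m V_eq x_notin)
  obtain a0 b1 where ab: "a0 \<in> A" "b1 \<in> B" "N x = {a0, b1}" by (rule N_x)
  show ?thesis by (rule T_if_edge[OF ab edge_if_subinvariant[OF z ab]])
qed

subsection \<open>The signless Laplacian\<close>

lemma eigenvalue_iff:
  assumes A: "A \<in> carrier_mat n n"
  shows "eigenvalue A c \<longleftrightarrow>
    (\<exists>x. (\<exists>i<n. x i \<noteq> 0) \<and> (\<forall>i<n. (\<Sum>j<n. A $$ (i, j) * x j) = c * x i))"
proof
  assume "eigenvalue A c"
  then obtain v where v: "v \<in> carrier_vec n" "v \<noteq> 0\<^sub>v n" "A *\<^sub>v v = c \<cdot>\<^sub>v v"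
    using A by (auto simp: eigenvalue_def eigenvector_def)
  have "\<exists>i<n. v $ i \<noteq> 0" using v(1,2) by (metis carrier_vecD eq_vecI index_zero_vec)
  moreover have "(\<Sum>j<n. A $$ (i, j) * v $ j) = c * v $ i" if "i < n" for i
  proof -
    have "(A *\<^sub>v v) $ i = c * v $ i" using v that by simp
    then show ?thesis using that v(1) A by (simp add: scalar_prod_def lessThan_atLeast0)
  qed
  ultimately show "\<exists>x. (\<exists>i<n. x i \<noteq> 0) \<and> (\<forall>i<n. (\<Sum>j<n. A $$ (i, j) * x j) = c * x i)"
    by (intro exI[of _ "\<lambda>i. v $ i"]) auto
next
  assume "\<exists>x. (\<exists>i<n. x i \<noteq> 0) \<and> (\<forall>i<n. (\<Sum>j<n. A $$ (i, j) * x j) = c * x i)"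
  then obtain x where x: "\<exists>i<n. x i \<noteq> 0" "\<And>i. i < n \<Longrightarrow> (\<Sum>j<n. A $$ (i, j) * x j) = c * x i"
    by auto
  have "A *\<^sub>v vec n x = c \<cdot>\<^sub>v vec n x"
    using x(2) A by (intro eq_vecI) (auto simp: scalar_prod_def lessThan_atLeast0)
  moreover have "vec n x \<noteq> 0\<^sub>v n" using x(1) by (metis index_vec index_zero_vec(1))
  ultimately show "eigenvalue A c"
    using A by (auto simp: eigenvalue_def eigenvector_def intro!: exI[of _ "vec n x"])
qed

text \<open>Makes the \<open>Max\<close> in the spectral radius meaningful. There is a complex
  eigenvalue \<open>c\<close>; by symmetry the Hermitian form \<open>s\<close> at its eigenvector is
  real, and it is \<open>c\<close> times a positive number. So \<open>c\<close> is real, and the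
  real or the imaginary part of the eigenvector is a real eigenvector.\<close>

lemma real_symmetric_spectrum_nonempty:
  fixes A :: "real mat"
  assumes A: "A \<in> carrier_mat n n" and n: "n > 0"
    and sym: "\<And>i j. i < n \<Longrightarrow> j < n \<Longrightarrow> A $$ (i, j) = A $$ (j, i)"
  shows "spectrum A \<noteq> {}"
proof -
  let ?C = "map_mat complex_of_real A"
  have C: "?C \<in> carrier_mat n n" using A by simp
  then obtain c where "eigenvalue ?C c"
    using spectrum_non_empty[OF C] n by (auto simp: spectrum_def)
  then obtain x where x0: "\<exists>i<n. x i \<noteq> 0"
    and "\<forall>i<n. (\<Sum>j<n. ?C $$ (i, j) * x j) = c * x i"
    unfolding eigenvalue_iff[OF C] by blast
  then have x: "(\<Sum>j<n. complex_of_real (A $$ (i, j)) * x j) = c * x i" if "i < n" for i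
    using that A by simp
  define s where "s = (\<Sum>i<n. \<Sum>j<n. cnj (x i) * (complex_of_real (A $$ (i, j)) * x j))"
  define r where "r = (\<Sum>i<n. (cmod (x i))\<^sup>2)"
  have "s = (\<Sum>i<n. cnj (x i) * (\<Sum>j<n. complex_of_real (A $$ (i, j)) * x j))"
    unfolding s_def by (simp add: sum_distrib_left)
  also have "\<dots> = (\<Sum>i<n. c * complex_of_real ((cmod (x i))\<^sup>2))"
    by (rule sum.cong[OF refl]) (simp add: x complex_norm_square del: of_real_power)
  finally have "s = \<dots>" .
  then have s: "s = c * complex_of_real r" by (simp add: r_def sum_distrib_left)
  have "cnj s = (\<Sum>i<n. \<Sum>j<n. cnj (x j) * (complex_of_real (A $$ (i, j)) * x i))"
    by (simp add: s_def mult_ac)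
  also have "\<dots> = (\<Sum>j<n. \<Sum>i<n. cnj (x j) * (complex_of_real (A $$ (i, j)) * x i))"
    by (rule sum.swap)
  also have "\<dots> = s" unfolding s_def using sym by (intro sum.cong) auto
  finally have "Im s = 0" by (metis cnj.simps(2) neg_equal_zero)
  moreover have "r > 0" unfolding r_def using x0 by (auto intro!: sum_pos2)
  ultimately have Im_c: "Im c = 0" using s by simp
  have Re_x: "(\<Sum>j<n. A $$ (i, j) * Re (x j)) = Re c * Re (x i)" if "i < n" for i
    using arg_cong[OF x[OF that], of Re] Im_c by simp
  have Im_x: "(\<Sum>j<n. A $$ (i, j) * Im (x j)) = Re c * Im (x i)" if "i < n" for i
    using arg_cong[OF x[OF that], of Im] Im_c by simp
  have "(\<exists>i<n. Re (x i) \<noteq> 0) \<or> (\<exists>i<n. Im (x i) \<noteq> 0)"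
    using x0 by (metis complex_eqI zero_complex.simps)
  then have "eigenvalue A (Re c)"
    unfolding eigenvalue_iff[OF A] using Re_x Im_x
    by (elim disjE) (rule exI[of _ "\<lambda>i. Re (x i)"] exI[of _ "\<lambda>i. Im (x i)"], simp)+
  then show ?thesis by (auto simp: spectrum_def)
qed

section \<open>Eigenvalue equations on the vertices of a graph\<close>

abbreviation nbrs :: "'a pair_pre_digraph \<Rightarrow> 'a \<Rightarrow> 'a set" where
  "nbrs G u \<equiv> {w. (u, w) \<in> parcs G}"

lemma out_degree_eq_card_nbrs: "out_degree (with_proj G) u = card (nbrs G u)"
proof -
  have "out_arcs (with_proj G) u = Pair u ` nbrs G u" by (auto simp: out_arcs_def)
  then show ?thesis by (simp add: out_degree_def card_image inj_on_def)
qed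

lemma signless_laplacian_carrier:
  "signless_laplacian G \<in> carrier_mat (card (pverts G)) (card (pverts G))"
  by (simp add: signless_laplacian_def degree_matrix_def adjacency_matrix_def)

lemma vertex_enum_bij:
  "finite (pverts G) \<Longrightarrow> bij_betw (vertex_enum G) {..<card (pverts G)} (pverts G)"
  unfolding vertex_enum_def lessThan_atLeast0 by (rule someI_ex[OF ex_bij_betw_nat_finite])

lemma signless_laplacian_index:
  "i < card (pverts G) \<Longrightarrow> j < card (pverts G) \<Longrightarrow> signless_laplacian G $$ (i, j)
    = (if i = j then real (card (nbrs G (vertex_enum G i))) else 0)
      + (if (vertex_enum G i, vertex_enum G j) \<in> parcs G then 1 else 0)"
  by (simp add: signless_laplacian_def degree_matrix_def adjacency_matrix_def mat_diag_def
    out_degree_eq_card_nbrs)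

text \<open>Reindexing along the bijection \<open>vertex_enum\<close> removes the arbitrary
  numbering of the vertices.\<close>

lemma spectrum_signless_laplacian_iff:
  fixes G :: "'a pair_pre_digraph"
  assumes fin: "finite (pverts G)" and wf: "pair_wf_digraph G"
  shows "c \<in> spectrum (signless_laplacian G) \<longleftrightarrow>
    (\<exists>x :: 'a \<Rightarrow> real. (\<exists>u\<in>pverts G. x u \<noteq> 0) \<and>
      (\<forall>u\<in>pverts G. card (nbrs G u) * x u + (\<Sum>w\<in>nbrs G u. x w) = c * x u))"
    (is "_ \<longleftrightarrow> (\<exists>x. ?Q x)")
proof -
  let ?n = "card (pverts G)" and ?e = "vertex_enum G" and ?V = "pverts G"
  interpret pair_wf_digraph G by (rule wf)
  have bij: "bij_betw ?e {..<?n} ?V" by (rule vertex_enum_bij[OF fin])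
  then have e_V: "?e ` {..<?n} = ?V" by (simp add: bij_betw_def)
  have row: "(\<Sum>j<?n. signless_laplacian G $$ (i, j) * x (?e j))
      = card (nbrs G (?e i)) * x (?e i) + (\<Sum>w\<in>nbrs G (?e i). x w)" if i: "i < ?n" for i and x :: "'a \<Rightarrow> real"
  proof -
    have "(\<Sum>j<?n. signless_laplacian G $$ (i, j) * x (?e j))
      = (\<Sum>j<?n. (if i = j then card (nbrs G (?e i)) * x (?e i) else 0)
          + (if (?e i, ?e j) \<in> parcs G then x (?e j) else 0))"
      using i by (intro sum.cong) (auto simp: signless_laplacian_index distrib_right)
    also have "\<dots> = card (nbrs G (?e i)) * x (?e i)
        + (\<Sum>j<?n. if (?e i, ?e j) \<in> parcs G then x (?e j) else 0)"
      using i by (simp add: sum.distrib)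
    also have "(\<Sum>j<?n. if (?e i, ?e j) \<in> parcs G then x (?e j) else 0)
        = (\<Sum>w\<in>?V. if (?e i, w) \<in> parcs G then x w else 0)"
      by (rule sum.reindex_bij_betw[OF bij])
    also have "\<dots> = (\<Sum>w\<in>?V \<inter> nbrs G (?e i). x w)"
      using fin by (simp add: sum.inter_restrict)
    also have "?V \<inter> nbrs G (?e i) = nbrs G (?e i)" using in_arcsD2 by auto
    finally show ?thesis .
  qed
  have "c \<in> spectrum (signless_laplacian G) \<longleftrightarrow> (\<exists>x. (\<exists>i<?n. x i \<noteq> 0) \<and>
      (\<forall>i<?n. (\<Sum>j<?n. signless_laplacian G $$ (i, j) * x j) = c * x i))"
    by (simp add: spectrum_def eigenvalue_iff[OF signless_laplacian_carrier])
  also have "\<dots> \<longleftrightarrow> (\<exists>x. ?Q x)"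
  proof
    assume "\<exists>x. (\<exists>i<?n. x i \<noteq> 0) \<and>
      (\<forall>i<?n. (\<Sum>j<?n. signless_laplacian G $$ (i, j) * x j) = c * x i)"
    then obtain x where x: "\<exists>i<?n. x i \<noteq> 0"
      "\<And>i. i < ?n \<Longrightarrow> (\<Sum>j<?n. signless_laplacian G $$ (i, j) * x j) = c * x i" by auto
    define z where "z u = x (the_inv_into {..<?n} ?e u)" for u
    have z: "z (?e i) = x i" if "i < ?n" for i
      using that bij by (simp add: z_def bij_betw_def the_inv_into_f_f)
    have "\<exists>u\<in>?V. z u \<noteq> 0" using x(1) z e_V by (metis imageI lessThan_iff)
    moreover have "card (nbrs G u) * z u + (\<Sum>w\<in>nbrs G u. z w) = c * z u" if u: "u \<in> ?V" for u
    proof -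
      obtain i where i: "i < ?n" "u = ?e i" using u e_V by auto
      have "(\<Sum>j<?n. signless_laplacian G $$ (i, j) * z (?e j))
          = (\<Sum>j<?n. signless_laplacian G $$ (i, j) * x j)"
        using z by (intro sum.cong) auto
      then show ?thesis using row[OF i(1), of z] x(2)[OF i(1)] z[OF i(1)] i(2) by simp
    qed
    ultimately show "\<exists>x. ?Q x" by blast
  next
    assume "\<exists>x. ?Q x"
    then obtain z where z: "?Q z" by blast
    then have "\<exists>i<?n. z (?e i) \<noteq> 0" using e_V by (metis imageE lessThan_iff)
    moreover have "(\<Sum>j<?n. signless_laplacian G $$ (i, j) * z (?e j)) = c * z (?e i)"
      if "i < ?n" for i
      using row[OF that, of z] z e_V that by auto
    ultimately show "\<exists>x. (\<exists>i<?n. x i \<noteq> 0) \<and>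
      (\<forall>i<?n. (\<Sum>j<?n. signless_laplacian G $$ (i, j) * x j) = c * x i)"
      by (intro exI[of _ "\<lambda>i. z (?e i)"]) auto
  qed
  finally show ?thesis .
qed

lemma spectrum_signless_laplacian:
  assumes "pair_graph G" and "pverts G \<noteq> {}"
  shows "finite (spectrum (signless_laplacian G))" "spectrum (signless_laplacian G) \<noteq> {}"
proof -
  interpret pair_graph G by fact
  let ?n = "card (pverts G)"
  show "finite (spectrum (signless_laplacian G))"
    by (rule card_finite_spectrum(1)[OF signless_laplacian_carrier])
  have sym: "(u, w) \<in> parcs G \<longleftrightarrow> (w, u) \<in> parcs G" for u w
    using pair_sym_arcs by (auto simp: symmetric_def dest: symD)
  show "spectrum (signless_laplacian G) \<noteq> {}"
  proof (rule real_symmetric_spectrum_nonempty[OF signless_laplacian_carrier])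
    show "0 < ?n" using assms(2) pair_finite_verts by (simp add: card_gt_0_iff)
    show "signless_laplacian G $$ (i, j) = signless_laplacian G $$ (j, i)"
      if "i < ?n" "j < ?n" for i j
      using that sym by (auto simp: signless_laplacian_index)
  qed
qed

text \<open>The ends of an arc in a pair graph determine the arc, so compatibility with tail and
  head forces the arc part of an isomorphism to be \<open>map_prod h h\<close>.\<close>

lemma digraph_iso_with_proj_iff:
  assumes "pair_wf_digraph G"
  shows "digraph_iso (with_proj G) (with_proj H) \<longleftrightarrow>
    (\<exists>h. inj_on h (pverts G) \<and> pverts H = h ` pverts G \<and> parcs H = map_prod h h ` parcs G)"
proof
  interpret pair_wf_digraph G by fact
  assume "digraph_iso (with_proj G) (with_proj H)"
  then obtain hom where hom: "pre_digraph.digraph_isomorphism (with_proj G) hom"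
    and H: "with_proj H = app_iso hom (with_proj G)" by (auto simp: digraph_iso_def)
  have "fst = iso_tail hom" "snd = iso_head hom" "pverts H = iso_verts hom ` pverts G"
    "parcs H = iso_arcs hom ` parcs G"
    using arg_cong[OF H, of tail] arg_cong[OF H, of head] arg_cong[OF H, of verts]
      arg_cong[OF H, of arcs] by simp_all
  moreover have "iso_arcs hom a = map_prod (iso_verts hom) (iso_verts hom) a" if "a \<in> parcs G" for a
    using hom that calculation(1,2)
    by (auto simp: pre_digraph.digraph_isomorphism_def prod_eq_iff)
  moreover have "inj_on (iso_verts hom) (pverts G)"
    using hom by (simp add: pre_digraph.digraph_isomorphism_def)
  ultimately show "\<exists>h. inj_on h (pverts G) \<and> pverts H = h ` pverts G \<and>
      parcs H = map_prod h h ` parcs G"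
    by (intro exI[of _ "iso_verts hom"]) auto
next
  interpret pair_wf_digraph G by fact
  assume "\<exists>h. inj_on h (pverts G) \<and> pverts H = h ` pverts G \<and> parcs H = map_prod h h ` parcs G"
  then obtain h where h: "inj_on h (pverts G)" "pverts H = h ` pverts G"
    "parcs H = map_prod h h ` parcs G" by blast
  let ?hom = "\<lparr>iso_verts = h, iso_arcs = map_prod h h, iso_head = snd, iso_tail = fst\<rparr>"
  have "parcs G \<subseteq> pverts G \<times> pverts G" using in_arcsD1 in_arcsD2 by auto
  then have "inj_on (map_prod h h) (parcs G)"
    using inj_on_subset[OF map_prod_inj_on[OF h(1) h(1)]] by blast
  then have "pre_digraph.digraph_isomorphism (with_proj G) ?hom"
    using h wf_digraph_axioms by (simp add: pre_digraph.digraph_isomorphism_def)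
  moreover have "with_proj H = app_iso ?hom (with_proj G)"
    using h by (simp add: app_iso_def with_proj_def)
  ultimately show "digraph_iso (with_proj G) (with_proj H)" by (auto simp: digraph_iso_def)
qed

section \<open>Copies of short cycles\<close>

lemma parcs_graph_of_edges: "parcs (graph_of_edges V E) = E \<union> E\<inverse>"
  by (auto simp: graph_of_edges_def parcs_mk_symmetric)

lemma pverts_graph_of_edges: "pverts (graph_of_edges V E) = V"
  by (simp add: graph_of_edges_def)

lemma contains_copy_cycle_graph:
  assumes "pair_graph G" and inj: "inj_on f {..<r}" and V: "f ` {..<r} \<subseteq> pverts G"
    and arcs: "\<And>i. i < r \<Longrightarrow> (f i, f (Suc i mod r)) \<in> parcs G"
  shows "contains_copy (with_proj G) (with_proj (cycle_graph r))"
proof -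
  interpret pair_graph G by fact
  have sym: "(u, w) \<in> parcs G \<Longrightarrow> (w, u) \<in> parcs G" for u w
    using pair_sym_arcs by (auto simp: symmetric_def dest: symD)
  let ?C = "cycle_graph r"
  define H where "H = \<lparr>pverts = f ` {..<r}, parcs = map_prod f f ` parcs ?C\<rparr>"
  have C: "parcs ?C = {(i, Suc i mod r) | i. i < r} \<union> {(i, Suc i mod r) | i. i < r}\<inverse>"
    "pverts ?C = {..<r}"
    by (simp_all add: cycle_graph_def parcs_graph_of_edges pverts_graph_of_edges)
  have sub: "parcs ?C \<subseteq> {..<r} \<times> {..<r}" unfolding C by auto
  have wf: "pair_wf_digraph H" using sub by unfold_locales (auto simp: H_def)
  let ?g = "the_inv_into {..<r} f"
  have g: "?g (f i) = i" if "i < r" for i using inj that by (simp add: the_inv_into_f_f)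
  have "map_prod ?g ?g ` map_prod f f ` parcs ?C = id ` parcs ?C"
    unfolding image_image using sub g by (intro image_cong) auto
  moreover have "?g ` f ` {..<r} = {..<r}" unfolding image_image using g by simp
  moreover have "inj_on ?g (f ` {..<r})" using inj by (rule inj_on_the_inv_into)
  ultimately have iso: "digraph_iso (with_proj H) (with_proj ?C)"
    unfolding digraph_iso_with_proj_iff[OF wf] by (intro exI[of _ ?g]) (simp add: H_def C(2))
  have "parcs H \<subseteq> parcs G" unfolding H_def C using arcs sym by auto
  then have "subgraph (with_proj H) (with_proj G)"
    using V wf wf_digraph_axioms
    by (auto simp: subgraph_def wf_digraph_wp_iff compatible_def H_def)
  with iso show ?thesis unfolding contains_copy_def by blast
qed

text \<open>A violation of \<open>no_triangle\<close> or \<open>no_4_cycle\<close> lists the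
  distinct vertices of a 3-cycle or 4-cycle in cyclic order.\<close>

lemma c34_free_nbrs:
  assumes G: "pair_graph G" and free: "family_free {cycle_graph 3, cycle_graph 4} G"
  shows "c34_free (pverts G) (nbrs G)"
proof -
  interpret pair_graph G by fact
  have sym: "(u, w) \<in> parcs G \<Longrightarrow> (w, u) \<in> parcs G" for u w
    using pair_sym_arcs by (auto simp: symmetric_def dest: symD)
  have irrefl: "(u, u) \<notin> parcs G" for u using pair_no_loops[of "(u, u)"] by auto
  have no_cycle: False
    if "distinct xs" "length xs = r" "r \<in> {3, 4}" "set xs \<subseteq> pverts G"
      "\<And>i. i < r \<Longrightarrow> (xs ! i, xs ! (Suc i mod r)) \<in> parcs G" for xs r
  proof -
    have "contains_copy (with_proj G) (with_proj (cycle_graph r))"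
      using that by (intro contains_copy_cycle_graph[OF G, of "\<lambda>i. xs ! i"])
        (auto simp: inj_on_def nth_eq_iff_index_eq)
    then show False using free that(3) by (auto simp: family_free_def)
  qed
  show ?thesis
  proof
    show "finite (pverts G)" by (rule pair_finite_verts)
    show "nbrs G u \<subseteq> pverts G" for u using in_arcsD2 by auto
    show "u \<notin> nbrs G u" for u using irrefl by simp
    show "u \<in> nbrs G w" if "w \<in> nbrs G u" for u w using that sym by simp
    show "nbrs G u \<inter> nbrs G w = {}" if "w \<in> nbrs G u" for u w
    proof (rule ccontr)
      assume "\<not> ?thesis"
      then obtain x where x: "(u, x) \<in> parcs G" "(w, x) \<in> parcs G" by auto
      have uw: "(u, w) \<in> parcs G" using that by simp
      have "u \<noteq> w" "u \<noteq> x" "w \<noteq> x" using uw x irrefl by auto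
      moreover have "u \<in> pverts G" "w \<in> pverts G" "x \<in> pverts G"
        using uw x(1) by (blast dest: in_arcsD1 in_arcsD2)+
      moreover have "([u, w, x] ! i, [u, w, x] ! (Suc i mod 3)) \<in> parcs G" if "i < 3" for i
      proof -
        from that consider "i = 0" | "i = 1" | "i = 2" by linarith
        then show ?thesis using uw x(2) sym[OF x(1)] by cases simp_all
      qed
      ultimately show False by (intro no_cycle[of "[u, w, x]" 3]) simp_all
    qed
    show "a = b" if "u \<noteq> w" "a \<in> nbrs G u \<inter> nbrs G w" "b \<in> nbrs G u \<inter> nbrs G w" for u w a b
    proof (rule ccontr)
      assume "a \<noteq> b"
      have p: "(u, a) \<in> parcs G" "(a, w) \<in> parcs G" "(w, b) \<in> parcs G" "(b, u) \<in> parcs G"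
        using that(2,3) by (blast intro: sym)+
      then have "u \<noteq> a" "a \<noteq> w" "w \<noteq> b" "b \<noteq> u" using irrefl by auto
      moreover have "u \<in> pverts G" "a \<in> pverts G" "w \<in> pverts G" "b \<in> pverts G"
        using p by (blast dest: in_arcsD1)+
      moreover have "([u, a, w, b] ! i, [u, a, w, b] ! (Suc i mod 4)) \<in> parcs G" if "i < 4" for i
      proof -
        from that consider "i = 0" | "i = 1" | "i = 2" | "i = 3" by linarith
        then show ?thesis using p by cases simp_all
      qed
      ultimately show False using that(1) \<open>a \<noteq> b\<close>
        by (intro no_cycle[of "[u, a, w, b]" 4]) simp_all
    qed
  qed
qed

subsection \<open>The extremal graph\<close>

lemma T_nbrs_subset: "k \<ge> 3 \<Longrightarrow> t \<in> T_verts k \<Longrightarrow> T_nbrs k t \<subseteq> T_verts k"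
  by (cases t) (auto simp: theta_verts_def)

text \<open>The function is constant on orbits of the automorphism that exchanges \<open>TX\<close>
  with \<open>TY\<close>, \<open>TA 0\<close> with \<open>TB 1\<close>, \<open>TA 1\<close> with
  \<open>TB 0\<close>, and \<open>TA i\<close> with \<open>TB i\<close> for the other paths. The
  equation at \<open>TX\<close> is then the assumed fixed-point equation of
  \<open>T_fraction\<close>.\<close>

lemma T_positive_eigenfunction:
  assumes k: "k \<ge> 22" and c: "c > k" and eq: "c - k = T_fraction k c"
  obtains p :: "theta_vertex \<Rightarrow> real" where "\<And>t. p t > 0"
    "\<And>t. t \<in> T_verts k \<Longrightarrow> card (T_nbrs k t) * p t + (\<Sum>s\<in>T_nbrs k t. p s) = c * p t"
proof -
  define m where "m = c - 2"
  have m: "m > 20" and cm: "c = m + 2" using k c by (auto simp: m_def)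
  have "m * (m - 1) > 3 * 1" using m by (intro mult_strict_mono) auto
  then have Q: "m\<^sup>2 - m - 3 > 0" by (simp add: power2_eq_square algebra_simps)
  \<comment> \<open>Found by eliminating \<open>b\<close> from \<open>m * b = 1 + a\<close> and
    \<open>(m - 1) * a = 1 + b + 2 * a / m\<close>, the equations at \<open>TB 0\<close> and
    \<open>TA 0\<close>.\<close>
  define a where "a = (m + 1) / (m\<^sup>2 - m - 3)"
  define b where "b = (1 + a) / m"
  define e where "e = 1 / (m - 1)"
  have "a > 0" using m Q by (simp add: a_def)
  then have pos: "a > 0" "b > 0" "e > 0" using m by (simp_all add: b_def e_def)
  have e: "(m - 1) * e = 1" using m by (simp add: e_def)
  have b: "m * b = 1 + a" using m by (simp add: b_def)
  have aQ: "a * (m\<^sup>2 - m - 3) = m + 1" using Q by (simp add: a_def)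
  have "m * ((m - 1) * a) = m * (1 + b + 2 * a / m)"
    using aQ b m by (simp add: power2_eq_square algebra_simps)
  then have a: "(m - 1) * a = 1 + b + 2 * a / m" using m by simp
  have hub: "m + 2 - k = 2 / m + a + b + (real k - 3) * e"
  proof -
    have "T_fraction k c = 2 / m + (real k - 3) / (m - 1) + (2 * m\<^sup>2 + m - 2) / (m * (m\<^sup>2 - m - 3))"
      unfolding T_fraction_def cm by (simp add: power2_eq_square algebra_simps)
    moreover have "(2 * m\<^sup>2 + m - 2) / (m * (m\<^sup>2 - m - 3)) = a + b"
    proof -
      have "m * (a + b) * (m\<^sup>2 - m - 3) = (m + 1) * (a * (m\<^sup>2 - m - 3)) + (m\<^sup>2 - m - 3)"
      proof -
        have "m * (a + b) = (m + 1) * a + 1" using b by (simp add: algebra_simps)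
        then show ?thesis by (simp add: distrib_right)
      qed
      also have "\<dots> = 2 * m\<^sup>2 + m - 2" using aQ by (simp add: power2_eq_square algebra_simps)
      finally have "(a + b) * (m * (m\<^sup>2 - m - 3)) = 2 * m\<^sup>2 + m - 2" by (simp only: mult_ac)
      moreover have "m * (m\<^sup>2 - m - 3) \<noteq> 0" using m Q by simp
      ultimately show ?thesis by (metis nonzero_divide_eq_eq)
    qed
    ultimately show ?thesis using eq cm by (simp add: e_def)
  qed
  define p where "p t = (case t of TX \<Rightarrow> 1 | TY \<Rightarrow> 1 | TM \<Rightarrow> 2 / m | TW \<Rightarrow> 2 * a / m
    | TA i \<Rightarrow> if i = 0 then a else if i = 1 then b else e
    | TB i \<Rightarrow> if i = 0 then b else if i = 1 then a else e)" for t
  have p [simp]: "p TX = 1" "p TY = 1" "p TM = 2 / m" "p TW = 2 * a / m"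
    "\<And>i. p (TA i) = (if i = 0 then a else if i = 1 then b else e)"
    "\<And>i. p (TB i) = (if i = 0 then b else if i = 1 then a else e)"
    by (auto simp: p_def)
  have split: "{..<k - 1} = insert 0 (insert 1 {2..<k - 1})" using k by auto
  have sum: "(\<Sum>i<k - 1. g i) = g 0 + g 1 + (real k - 3) * e"
    if "\<And>i. i \<ge> 2 \<Longrightarrow> g i = e" for g :: "nat \<Rightarrow> real"
  proof -
    have "(\<Sum>i = 2..<k - 1. g i) = (\<Sum>i = 2..<k - 1. e)" using that by (intro sum.cong) auto
    also have "\<dots> = (real k - 3) * e" using k by (simp add: of_nat_diff)
    finally show ?thesis unfolding split by simp
  qed
  show thesis
  proof (rule that)
    show "p t > 0" for t using pos m by (cases t) auto
    fix t assume "t \<in> T_verts k"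
    then consider "t = TX" | "t = TY" | "t = TM" | "t = TW" | i where "t = TA i" | i where "t = TB i"
      by (cases t) auto
    then show "card (T_nbrs k t) * p t + (\<Sum>s\<in>T_nbrs k t. p s) = c * p t"
    proof cases
      case 1
      have "(\<Sum>s\<in>TA ` {..<k - 1}. p s) = (\<Sum>i<k - 1. p (TA i))"
        by (subst sum.reindex) (auto simp: inj_on_def)
      also have "\<dots> = a + b + (real k - 3) * e" by (subst sum) auto
      finally have "(\<Sum>s\<in>TA ` {..<k - 1}. p s) = a + b + (real k - 3) * e" .
      moreover have "card (TA ` {..<k - 1}) = k - 1" by (simp add: card_image inj_on_def)
      moreover have "TM \<notin> TA ` {..<k - 1}" by auto
      ultimately show ?thesis using 1 hub k cm by (simp add: of_nat_diff)
    next
      case 2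
      have "(\<Sum>s\<in>TB ` {..<k - 1}. p s) = (\<Sum>i<k - 1. p (TB i))"
        by (subst sum.reindex) (auto simp: inj_on_def)
      also have "\<dots> = b + a + (real k - 3) * e" by (subst sum) auto
      finally have "(\<Sum>s\<in>TB ` {..<k - 1}. p s) = b + a + (real k - 3) * e" .
      moreover have "card (TB ` {..<k - 1}) = k - 1" by (simp add: card_image inj_on_def)
      moreover have "TM \<notin> TB ` {..<k - 1}" by auto
      ultimately show ?thesis using 2 hub k cm by (simp add: of_nat_diff)
    next
      case 3
      then show ?thesis using m cm by (simp add: field_simps)
    next
      case 4
      then show ?thesis using m cm by (simp add: field_simps)
    next
      case 5
      then show ?thesis using a b e cm by (simp add: card_insert_if algebra_simps)
    next
      case 6
      then show ?thesis using a b e cm by (simp add: card_insert_if algebra_simps)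
    qed
  qed
qed

section \<open>Isomorphism with \<open>T_graph\<close> in terms of neighbourhoods\<close>

lemma pverts_T_graph: "pverts (T_graph k) = T_verts k"
  by (simp add: T_graph_def pverts_graph_of_edges)

text \<open>The bound on \<open>k\<close> guarantees that \<open>TB 1\<close>, a neighbour of
  \<open>TW\<close>, is a vertex.\<close>

lemma parcs_T_graph:
  assumes "k \<ge> 3"
  shows "(s, t) \<in> parcs (T_graph k) \<longleftrightarrow> s \<in> T_verts k \<and> t \<in> T_nbrs k s"
  using assms
  by (cases s; cases t) (auto simp: T_graph_def parcs_graph_of_edges theta_edges_def theta_verts_def)

lemma digraph_iso_T_graph_iff:
  assumes G: "pair_wf_digraph G" and k: "k \<ge> 3"
  shows "digraph_iso (with_proj G) (with_proj (T_graph k)) \<longleftrightarrow>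
    (\<exists>f. bij_betw f (T_verts k) (pverts G) \<and> (\<forall>t\<in>T_verts k. nbrs G (f t) = f ` T_nbrs k t))"
proof -
  interpret G: pair_wf_digraph G by fact
  have arcs: "parcs (T_graph k) = (SIGMA t:T_verts k. T_nbrs k t)"
    using parcs_T_graph[OF k] by auto
  have sub: "parcs (T_graph k) \<subseteq> T_verts k \<times> T_verts k"
    unfolding arcs using T_nbrs_subset[OF k] by blast
  have T: "pair_wf_digraph (T_graph k)" using sub by unfold_locales (auto simp: pverts_T_graph)
  have "digraph_iso (with_proj G) (with_proj (T_graph k))
      \<longleftrightarrow> digraph_iso (with_proj (T_graph k)) (with_proj G)"
    using digraph_iso_swap[OF G[folded wf_digraph_wp_iff]] digraph_iso_swap[OF T[folded wf_digraph_wp_iff]]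
    by blast
  also have "\<dots> \<longleftrightarrow> (\<exists>f. bij_betw f (T_verts k) (pverts G) \<and> parcs G = map_prod f f ` parcs (T_graph k))"
    unfolding digraph_iso_with_proj_iff[OF T] by (auto simp: bij_betw_def pverts_T_graph)
  also have "\<dots> \<longleftrightarrow> (\<exists>f. bij_betw f (T_verts k) (pverts G) \<and> (\<forall>t\<in>T_verts k. nbrs G (f t) = f ` T_nbrs k t))"
  proof (rule arg_cong[of _ _ Ex], rule ext, rule conj_cong[OF refl])
    fix f assume f: "bij_betw f (T_verts k) (pverts G)"
    then have inj: "f s = f t \<longleftrightarrow> s = t" if "s \<in> T_verts k" "t \<in> T_verts k" for s t
      using that by (auto simp: bij_betw_def inj_on_def)
    have img: "f ` T_verts k = pverts G" using f by (simp add: bij_betw_def)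
    have *: "(f t, w) \<in> map_prod f f ` parcs (T_graph k) \<longleftrightarrow> w \<in> f ` T_nbrs k t"
      if "t \<in> T_verts k" for t w
    proof
      assume "(f t, w) \<in> map_prod f f ` parcs (T_graph k)"
      then obtain s r where sr: "(s, r) \<in> parcs (T_graph k)" "f t = f s" "w = f r" by auto
      then have "s \<in> T_verts k" using sub by blast
      then have "s = t" using inj[OF that, of s] sr(2) by blast
      then show "w \<in> f ` T_nbrs k t" using sr(1,3) unfolding arcs by simp
    next
      assume "w \<in> f ` T_nbrs k t"
      then obtain r where r: "r \<in> T_nbrs k t" "w = f r" by (rule imageE)
      then have "(t, r) \<in> parcs (T_graph k)" unfolding arcs using that by simp
      then show "(f t, w) \<in> map_prod f f ` parcs (T_graph k)"
        unfolding r(2) by (intro map_prod_imageI)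
    qed
    show "parcs G = map_prod f f ` parcs (T_graph k) \<longleftrightarrow> (\<forall>t\<in>T_verts k. nbrs G (f t) = f ` T_nbrs k t)"
    proof
      assume "parcs G = map_prod f f ` parcs (T_graph k)"
      then show "\<forall>t\<in>T_verts k. nbrs G (f t) = f ` T_nbrs k t" using * by auto
    next
      assume N: "\<forall>t\<in>T_verts k. nbrs G (f t) = f ` T_nbrs k t"
      have "(u, w) \<in> parcs G \<longleftrightarrow> (u, w) \<in> map_prod f f ` parcs (T_graph k)" for u w
      proof (cases "u \<in> pverts G")
        case True
        then obtain t where t: "t \<in> T_verts k" "u = f t" using img by blast
        have "nbrs G (f t) = f ` T_nbrs k t" using N t(1) by (rule bspec)
        then show ?thesis unfolding t(2) *[OF t(1)] by blast
      next
        case False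
        then have "(u, w) \<notin> parcs G" using G.in_arcsD1 by blast
        moreover have "(u, w) \<notin> map_prod f f ` parcs (T_graph k)" using False sub img by auto
        ultimately show ?thesis by simp
      qed
      then show "parcs G = map_prod f f ` parcs (T_graph k)" by auto
    qed
  qed
  finally show ?thesis .
qed

text \<open>The spectral radius is itself an eigenvalue. If it reaches \<open>q'(n)\<close>, then
  the graph is \<open>T_k\<close>, whose radius is exactly \<open>q'(n)\<close>; this yields the
  bound and the equality case together.\<close>

theorem theorem3p2:
  fixes k n :: nat and G :: "'a pair_pre_digraph"
  assumes "k \<ge> 22"
    and "n = 2 * k + 2"
    and "pair_graph G"
    and "Digraph_Component.connected (with_proj G)"
    and "card (pverts G) = n"
    and "family_free {cycle_graph 3, cycle_graph 4} G"
    and "\<not> (\<exists>v. pendant_vertex G v)"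
  shows "signless_spectral_radius G \<le> q'_bound n \<and>
         (signless_spectral_radius G = q'_bound n \<longleftrightarrow>
           digraph_iso (with_proj G) (with_proj (T_graph ((n - 2) div 2))))"
proof -
  interpret G: pair_graph G by fact
  interpret c34_free "pverts G" "nbrs G" by (rule c34_free_nbrs) fact+
  have wf: "pair_wf_digraph G" by unfold_locales
  let ?V = "pverts G" and ?q = "q'_bound n"
  have r: "(n - 2) div 2 = k" using assms(2) by simp
  note q = q'_bound[OF assms(1,2)]
  note spectrum_iff = spectrum_signless_laplacian_iff[OF finite_V wf]
  \<comment> \<open>Degree 0 contradicts connectedness, as there is a second vertex, and degree 1
    would be a pendant vertex.\<close>
  have deg: "d u \<ge> 2" if u: "u \<in> ?V" for u
  proof -
    have "?V \<noteq> {u}" using assms(1,2,5) by auto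
    then obtain w where w: "w \<in> ?V" "w \<noteq> u" using u by auto
    have "(u, w) \<in> rtrancl_on ?V (parcs (mk_symmetric (with_proj G)))"
      using assms(4) u w by (auto simp: connected_def strongly_connected_def reachable_def)
    then have "(u, w) \<in> (parcs (mk_symmetric (with_proj G)))\<^sup>*"
      by (rule rtrancl_on_rtranclI)
    then obtain t where "(u, t) \<in> parcs (mk_symmetric (with_proj G))"
      using w(2) by (metis converse_rtranclE)
    then have "(u, t) \<in> parcs G \<or> (t, u) \<in> parcs G" by (auto simp: parcs_mk_symmetric)
    then have "t \<in> nbrs G u" using nbrs_sym[of t u] G.in_arcsD1 by auto
    then have "d u \<noteq> 0" using u by auto
    moreover have "d u \<noteq> 1" using assms(7) u by (auto simp: pendant_vertex_def out_degree_eq_card_nbrs)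
    ultimately show ?thesis by linarith
  qed
  have large: "c34_free_large ?V (nbrs G) k c" if "c \<ge> ?q" for c
    using assms(1,2,5) deg q(1) q(3)[OF that] that by unfold_locales auto
  have sub: "subinvariant c (\<lambda>u. \<bar>x u\<bar>)"
    if x: "\<exists>u\<in>?V. x u \<noteq> 0" "\<forall>u\<in>?V. d u * x u + (\<Sum>w\<in>nbrs G u. x w) = c * x u" and c: "c > k"
    for x :: "'a \<Rightarrow> real" and c :: real
  proof -
    have "(c - d u) * \<bar>x u\<bar> \<le> (\<Sum>w\<in>nbrs G u. \<bar>x w\<bar>)" if u: "u \<in> ?V" for u
    proof -
      have "(c - d u) * x u = (\<Sum>w\<in>nbrs G u. x w)"
        using bspec[OF x(2) u] by (simp add: left_diff_distrib)
      then have "\<bar>c - d u\<bar> * \<bar>x u\<bar> = \<bar>\<Sum>w\<in>nbrs G u. x w\<bar>" by (metis abs_mult)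
      also have "\<dots> \<le> (\<Sum>w\<in>nbrs G u. \<bar>x w\<bar>)" by (rule sum_abs)
      finally show ?thesis by (meson abs_ge_self abs_ge_zero mult_right_mono order_trans)
    qed
    moreover have "\<exists>u\<in>?V. \<bar>x u\<bar> > 0" using x(1) by simp
    ultimately show ?thesis by (simp add: subinvariant_def)
  qed
  have iso_iff: "digraph_iso (with_proj G) (with_proj (T_graph k)) \<longleftrightarrow>
      (\<exists>f. bij_betw f (T_verts k) ?V \<and> (\<forall>t\<in>T_verts k. nbrs G (f t) = f ` T_nbrs k t))"
    by (rule digraph_iso_T_graph_iff[OF wf]) (use assms(1) in simp)
  have iso: "digraph_iso (with_proj G) (with_proj (T_graph k))"
    if c: "c \<in> spectrum (signless_laplacian G)" "c \<ge> ?q" for c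
  proof -
    from c(1)[unfolded spectrum_iff] obtain x :: "'a \<Rightarrow> real"
      where x: "\<exists>u\<in>?V. x u \<noteq> 0" "\<forall>u\<in>?V. d u * x u + (\<Sum>w\<in>nbrs G u. x w) = c * x u"
      by (elim exE conjE)
    have "subinvariant c (\<lambda>u. \<bar>x u\<bar>)" by (rule sub[OF x]) (use c(2) q(1) in simp)
    then show ?thesis
      unfolding iso_iff by (rule c34_free_large.T_if_subinvariant[OF large[OF c(2)]])
  qed
  have ne: "?V \<noteq> {}" using assms(2,5) by auto
  note spec = spectrum_signless_laplacian[OF assms(3) ne]
  have radius: "signless_spectral_radius G \<in> spectrum (signless_laplacian G)"
    unfolding signless_spectral_radius_def by (rule Max_in[OF spec])
  have T: "signless_spectral_radius G = ?q"
    if T: "digraph_iso (with_proj G) (with_proj (T_graph k))"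
  proof -
    from T[unfolded iso_iff] obtain f where f: "bij_betw f (T_verts k) ?V"
      and f_nbrs: "\<forall>t\<in>T_verts k. nbrs G (f t) = f ` T_nbrs k t"
      by (elim exE conjE)
    obtain p :: "theta_vertex \<Rightarrow> real" where p: "\<And>t. p t > 0"
      "\<And>t. t \<in> T_verts k \<Longrightarrow> card (T_nbrs k t) * p t + (\<Sum>s\<in>T_nbrs k t. p s) = ?q * p t"
      using T_positive_eigenfunction[OF assms(1) q(1,2)] by blast
    define w where "w u = p (the_inv_into (T_verts k) f u)" for u
    have wf': "w (f t) = p t" if "t \<in> T_verts k" for t
      using f that by (simp add: w_def bij_betw_def the_inv_into_f_f)
    have w: "d u * w u + (\<Sum>s\<in>nbrs G u. w s) = ?q * w u" if u: "u \<in> ?V" for u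
    proof -
      obtain t where t: "t \<in> T_verts k" "u = f t" using u f by (auto simp: bij_betw_def)
      have Nt: "nbrs G u = f ` T_nbrs k t" unfolding t(2) by (rule bspec[OF f_nbrs t(1)])
      have sub: "T_nbrs k t \<subseteq> T_verts k" using T_nbrs_subset t assms(1) by auto
      then have inj: "inj_on f (T_nbrs k t)" by (rule inj_on_subset[OF bij_betw_imp_inj_on[OF f]])
      have "(\<Sum>s\<in>nbrs G u. w s) = (\<Sum>s\<in>T_nbrs k t. p s)"
        unfolding Nt sum.reindex[OF inj] using wf' sub by (intro sum.cong) auto
      moreover have "d u = card (T_nbrs k t)" unfolding Nt by (rule card_image[OF inj])
      ultimately show ?thesis using p(2)[OF t(1)] wf'[OF t(1)] t(2) by simp
    qed
    have w0: "w u > 0" for u by (simp add: w_def p)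
    have "?q \<in> spectrum (signless_laplacian G)"
      unfolding spectrum_iff using w w0 ne by (intro exI[of _ w]) (metis all_not_in_conv less_irrefl)
    \<comment> \<open>The positive eigenfunction \<open>w\<close> for \<open>q'(n)\<close> is a
      strict test function for every larger \<open>c\<close>, so \<open>q'(n)\<close> is the largest
      eigenvalue.\<close>
    moreover have "c \<le> ?q" if c: "c \<in> spectrum (signless_laplacian G)" for c
    proof (rule ccontr)
      assume "\<not> c \<le> ?q"
      then have gt: "c > ?q" by simp
      from c[unfolded spectrum_iff] obtain x :: "'a \<Rightarrow> real"
        where x: "\<exists>u\<in>?V. x u \<noteq> 0" "\<forall>u\<in>?V. d u * x u + (\<Sum>w\<in>nbrs G u. x w) = c * x u"
        by (elim exE conjE)
      have z: "subinvariant c (\<lambda>u. \<bar>x u\<bar>)" by (rule sub[OF x]) (use gt q(1) in simp)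
      show False
      proof (rule no_subinvariant_if_strict_superharmonic[OF z])
        show "w u \<ge> 0" for u using w0 by (simp add: less_imp_le)
        show "(\<Sum>s\<in>nbrs G u. w s) < (c - d u) * w u" if "u \<in> ?V" for u
        proof -
          have "(\<Sum>s\<in>nbrs G u. w s) = (?q - d u) * w u"
            using w[OF that] by (simp add: left_diff_distrib)
          also have "\<dots> < (c - d u) * w u" using gt w0 by (intro mult_strict_right_mono) auto
          finally show ?thesis .
        qed
      qed
    qed
    ultimately show ?thesis
      unfolding signless_spectral_radius_def using spec(1) by (intro Max_eqI) auto
  qed
  show ?thesis unfolding r using iso[OF radius] T by (metis linorder_le_cases order_refl)
qed

end
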